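(* Let $\underline\omega_0$ be a limit state on the scaling algebra $\underline{\mathfrak A}$, with GNS objects $(\mathcal H_0,\pi_0,\Omega_0)$ and associated implementation $U_0$ of $\mathcal P_+^\uparrow$. Let $\mathcal Z$ be a compact Hausdorff space, $\nu$ a regular Borel probability measure on $\mathcal Z$, and $\underline\omega_z$ ($z\in\mathcal Z$) multiplicative limit states with GNS objects $(\mathcal H_z,\pi_z,\Omega_z)$ such that $\underline\omega_0(\underline A)=\int_{\mathcal Z}d\nu(z)\,\underline\omega_z(\underline A)$ for all $\underline A\in\underline{\mathfrak A}$ and such that $\underline C\mapsto(z\mapsto\underline\omega_z(\underline C))$ is a (well-defined) surjective map $\mathfrak Z(\underline{\mathfrak A})\to\mathcal C(\mathcal Z)$. Identify $\mathcal H_0$ with $\int_{\mathcal Z}^\Gamma d\nu(z)\,\mathcal H_z$, where $\Gamma=\{z\mapsto\pi_z(\underline A)\Omega_z\,|\,\underline A\in\underline{\mathfrak A}\}$, via the unitary $\pi_0(\underline A)\Omega_0\mapsto\int_{\mathcal Z}^\Gamma d\nu(z)\,\pi_z(\underline A)\Omega_z$. Let $g\mapsto U_z(g)$ be the implementation of $\mathcal P_+^\uparrow$ on the limit Hilbert space $\mathcal H_z$ corresponding to $\underline\omega_z$. Then $$U_0(g)=\int_{\mathcal Z}^\Gamma d\nu(z)\,U_z(g)\quad\text{for all }g\in\mathcal P_+^\uparrow.$$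
   Context: Nets. Minkowski space is $\mathbb R^{s+1}$. A net of algebras assigns to each open bounded region $\mathcal O\subset\mathbb R^{s+1}$ a C*-algebra $\mathfrak A(\mathcal O)$ with $\mathfrak A(\mathcal O_1)\subset\mathfrak A(\mathcal O_2)$ if $\mathcal O_1\subset\mathcal O_2$; $\mathfrak A$ also denotes the quasilocal algebra (C*-inductive limit). A local net with symmetry group $\mathcal G$ (a Lie group of point transformations of Minkowski space containing the translations) is a net with a representation $g\mapsto\alpha_g$ of $\mathcal G$ by automorphisms such that (i) $[A_1,A_2]=0$ if $A_i\in\mathfrak A(\mathcal O_i)$ with $\mathcal O_1,\mathcal O_2$ spacelike separated, (ii) $\alpha_g\mathfrak A(\mathcal O)=\mathfrak A(g.\mathcal O)$. It is in a positive energy representation if moreover the $\mathfrak A(\mathcal O)$ are W*-algebras on a common Hilbert space $\mathcal H$, $\alpha_g=\mathrm{ad}\,U(g)$ for a strongly continuous unitary representation $U$ of $\mathcal G$, the joint spectrum of the generators of the translations lies in the closed forward light cone, and there is a vector $\Omega\in\mathcal H$ invariant under all $U(g)$ and cyclic for $\mathfrak A$. It is in the vacuum sector if moreover $\Omega$ is unique up to scalars as a translation-invariant vector. Standing assumption: $\mathfrak A$ is a fixed local net in the vacuum sector with symmetry group the Poincaré group $\mathcal P_+^\uparrow$; $\omega=(\Omega|\,\cdot\,\Omega)$. Scaling algebra. $\underline{\mathfrak B}$ is the C*-algebra of bounded functions $\underline B:\mathbb R_+\to\mathcal B(\mathcal H)$, $\lambda\mapsto\underline B_\lambda$, with pointwise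 operations and norm $\sup_\lambda\|\underline B_\lambda\|$. $\underline{\mathcal G}$ is the group generated by Poincaré transformations and dilations, with elements $g=(\mu,x,\Lambda)$, $\mu\in\mathbb R_+$; it acts by $(\underline\alpha_g\underline B)_\lambda=\alpha_{\lambda\mu x,\Lambda}(\underline B_{\lambda\mu})$. Put $\underline{\mathfrak A}(\mathcal O)=\{\underline A\in\underline{\mathfrak B}\,|\,\underline A_\lambda\in\mathfrak A(\lambda\mathcal O)\ \forall\lambda>0,\ g\mapsto\underline\alpha_g(\underline A)\text{ norm continuous}\}$; $\underline{\mathfrak A}$ is the associated quasilocal C*-algebra. Its center $\mathfrak Z(\underline{\mathfrak A})$ consists of the functions $\lambda\mapsto f(\lambda)\mathbf 1$ with $f:\mathbb R_+\to\mathbb C$ bounded and uniformly continuous with respect to the multiplicative group structure. Limit states. A mean $\mathsf m$ is a state on $\mathfrak Z(\underline{\mathfrak A})$; it is asymptotic if $\mathsf m(f)=0$ whenever $f(\lambda)=0$ for small $\lambda$, and multiplicative if $\mathsf m(fg)=\mathsf m(f)\mathsf m(g)$. Let $\omega:\underline{\mathfrak A}\to\mathfrak Z(\underline{\mathfrak A})$, $(\omega(\underline A))_\lambda=\omega(\underline A_\lambda)\mathbf 1$. A limit state is a state $\underline\omega_0=\mathsf m\circ\omega$ on $\underline{\mathfrak A}$ with $\mathsf m$ an asymptotic mean; it is called multiplicative if $\mathsf m$ is. Every limit state is invariant under $\underline\alpha_g$, $g\in\mathcal P_+^\uparrow$, and its implementation of $\mathcal P_+^\uparrow$ is the strongly continuous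 unitary representation $U_0(g)\pi_0(\underline A)\Omega_0=\pi_0(\underline\alpha_g\underline A)\Omega_0$ on the GNS space (for $\underline\omega_z$: $U_z(g)\pi_z(\underline A)\Omega_z=\pi_z(\underline\alpha_g\underline A)\Omega_z$). Direct integrals. Let $\mathcal Z$ be compact Hausdorff with finite regular Borel measure $\nu$ and $\mathcal H_z$, $z\in\mathcal Z$, Hilbert spaces (no separability assumed). A fundamental family is a linear subspace $\Gamma\subset\prod_z\mathcal H_z$ such that $z\mapsto\|\chi(z)\|^2$ is $\nu$-integrable for each $\chi\in\Gamma$. It extends to a unique minimal vector space $\bar\Gamma\supset\Gamma$ in $\prod_z\mathcal H_z$ such that: $z\mapsto\|\chi(z)\|^2$ is integrable for $\chi\in\bar\Gamma$; $\bar\Gamma$ is closed under a.e. modification and under multiplication by $L^\infty(\mathcal Z,\nu)$ functions; $\bar\Gamma$ is complete in the seminorm $(\int d\nu(z)\|\chi(z)\|^2)^{1/2}$. The direct integral $\int_{\mathcal Z}^\Gamma d\nu(z)\mathcal H_z$ is $\bar\Gamma$ modulo vectors of zero seminorm. (It is a fact that the set $\Gamma$ in the claim is a fundamental family and the indicated map extends to a unitary.) The equation $B=\int_{\mathcal Z}^\Gamma d\nu(z)B(z)$ for an operator $B$ means: $B(z)\in\mathcal B(\mathcal H_z)$, $\mathrm{ess\,sup}_z\|B(z)\|<\infty$, $z\mapsto B(z)\chi(z)$ lies in $\bar\Gamma$ for each $\chi\in\bar\Gamma$, and $(B\chi)(z)=B(z)\chi(z)$ a.e. *)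

theory Defs
  imports "HOL-Probability.Probability_Measure"
begin

section \<open>Complex Hilbert spaces and bounded operators\<close>

text \<open>The inner product \<open>cinner\<close> is antilinear in its first and linear in its second argument; its
  real part is the real inner product that induces the norm.\<close>

class chilbert = real_inner + complete_space +
  fixes scaleC :: "complex \<Rightarrow> 'a \<Rightarrow> 'a"  (infixr \<open>*\<^sub>C\<close> 75)
    and cinner :: "'a \<Rightarrow> 'a \<Rightarrow> complex"
  assumes scaleC_add_right: "c *\<^sub>C (x + y) = c *\<^sub>C x + c *\<^sub>C y"
    and scaleC_add_left: "(c + d) *\<^sub>C x = c *\<^sub>C x + d *\<^sub>C x"
    and scaleC_scaleC: "c *\<^sub>C (d *\<^sub>C x) = (c * d) *\<^sub>C x"
    and scaleC_of_real: "complex_of_real r *\<^sub>C x = r *\<^sub>R x"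
    and cinner_commute: "cinner x y = cnj (cinner y x)"
    and cinner_add_right: "cinner x (y + z) = cinner x y + cinner x z"
    and cinner_scaleC_right: "cinner x (c *\<^sub>C y) = c * cinner x y"
    and Re_cinner: "Re (cinner x y) = inner x y"

text \<open>\<open>'h \<Rightarrow>\<^sub>L 'h\<close> is the library type of bounded real-linear operators (with the operator norm);
  the bounded operators on the complex Hilbert space are its complex-linear elements.\<close>

type_synonym 'h opr = "'h \<Rightarrow>\<^sub>L 'h"

definition bounded_oprs :: "'h::chilbert opr set" where
  "bounded_oprs = {T. \<forall>c x. blinfun_apply T (c *\<^sub>C x) = c *\<^sub>C blinfun_apply T x}"

definition adj :: "'h::chilbert opr \<Rightarrow> 'h opr" where
  "adj T = (THE S. S \<in> bounded_oprs \<and>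
     (\<forall>x y. cinner (blinfun_apply S x) y = cinner x (blinfun_apply T y)))"

definition scalar_opr :: "complex \<Rightarrow> 'h::chilbert opr" where
  "scalar_opr c = Blinfun (\<lambda>x. c *\<^sub>C x)"

definition commutant :: "'h::chilbert opr set \<Rightarrow> 'h opr set" where
  "commutant M = {T \<in> bounded_oprs. \<forall>A\<in>M. T o\<^sub>L A = A o\<^sub>L T}"

definition von_neumann_algebra :: "'h::chilbert opr set \<Rightarrow> bool" where
  "von_neumann_algebra M \<longleftrightarrow>
     M \<subseteq> bounded_oprs \<and> (\<forall>T\<in>M. adj T \<in> M) \<and> commutant (commutant M) = M"

text \<open>Families of Hilbert spaces with varying \<open>H z\<close> (and GNS spaces) are represented as closed
  complex subspaces of a type of class \<open>chilbert\<close>, which is an arbitrary type variable; any family of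
  Hilbert spaces is of this form up to isomorphism, the ambient space being for example the Hilbert
  sum. Operators on such a subspace are functions of which only the values on the subspace matter.\<close>

definition hilbert_subspace :: "'k::chilbert set \<Rightarrow> bool" where
  "hilbert_subspace H \<longleftrightarrow> closed H \<and> 0 \<in> H \<and> (\<forall>x\<in>H. \<forall>y\<in>H. x + y \<in> H) \<and> (\<forall>c. \<forall>x\<in>H. c *\<^sub>C x \<in> H)"

definition clinear_on :: "'k::chilbert set \<Rightarrow> ('k \<Rightarrow> 'k) \<Rightarrow> bool" where
  "clinear_on H T \<longleftrightarrow> (\<forall>x\<in>H. \<forall>y\<in>H. T (x + y) = T x + T y) \<and> (\<forall>c. \<forall>x\<in>H. T (c *\<^sub>C x) = c *\<^sub>C T x)"

definition bounded_opr_on :: "'k::chilbert set \<Rightarrow> ('k \<Rightarrow> 'k) \<Rightarrow> bool" where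
  "bounded_opr_on H T \<longleftrightarrow> T ` H \<subseteq> H \<and> clinear_on H T \<and> (\<exists>M. \<forall>x\<in>H. norm (T x) \<le> M * norm x)"

definition opr_norm_on :: "'k::chilbert set \<Rightarrow> ('k \<Rightarrow> 'k) \<Rightarrow> real" where
  "opr_norm_on H T = (SUP x\<in>{x\<in>H. norm x \<le> 1}. norm (T x))"

definition unitary_on :: "'k::chilbert set \<Rightarrow> ('k \<Rightarrow> 'k) \<Rightarrow> bool" where
  "unitary_on H V \<longleftrightarrow> V ` H = H \<and> clinear_on H V \<and> (\<forall>x\<in>H. \<forall>y\<in>H. cinner (V x) (V y) = cinner x y)"


section \<open>Minkowski space and the Poincare group\<close>

text \<open>Spacetime has \<open>CARD('s) + 1\<close> coordinates; \<open>None\<close> is the time index.\<close>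

type_synonym 's minkowski = "real ^ ('s option)"
type_synonym 's lorentz = "real ^ ('s option) ^ ('s option)"
type_synonym 's poincare = "'s minkowski \<times> 's lorentz"

definition mink :: "'s::finite minkowski \<Rightarrow> 's minkowski \<Rightarrow> real" where
  "mink x y = x $ None * y $ None - (\<Sum>i\<in>UNIV. x $ Some i * y $ Some i)"

definition forward_cone :: "'s::finite minkowski set" where
  "forward_cone = {p. mink p p \<ge> 0 \<and> p $ None \<ge> 0}"

definition spacelike_separated :: "'s::finite minkowski set \<Rightarrow> 's minkowski set \<Rightarrow> bool" where
  "spacelike_separated R1 R2 \<longleftrightarrow> (\<forall>x\<in>R1. \<forall>y\<in>R2. mink (x - y) (x - y) < 0)"

definition lorentz_group :: "'s::finite lorentz set" where
  "lorentz_group =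
     {L. (\<forall>x y. mink (L *v x) (L *v y) = mink x y) \<and> det L = 1 \<and> L $ None $ None > 0}"

definition poincare_group :: "'s::finite poincare set" where
  "poincare_group = UNIV \<times> lorentz_group"

definition poincare_mult :: "'s::finite poincare \<Rightarrow> 's poincare \<Rightarrow> 's poincare" where
  "poincare_mult g h = (fst g + snd g *v fst h, snd g ** snd h)"

definition poincare_act :: "'s::finite poincare \<Rightarrow> 's minkowski \<Rightarrow> 's minkowski" where
  "poincare_act g y = snd g *v y + fst g"

definition unitary_rep :: "'k::chilbert set \<Rightarrow> ('s::finite poincare \<Rightarrow> 'k \<Rightarrow> 'k) \<Rightarrow> bool" where
  "unitary_rep H U \<longleftrightarrow>
     (\<forall>g\<in>poincare_group. unitary_on H (U g)) \<and>
     (\<forall>\<psi>\<in>H. U (0, mat 1) \<psi> = \<psi>) \<and>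
     (\<forall>g\<in>poincare_group. \<forall>h\<in>poincare_group. \<forall>\<psi>\<in>H. U (poincare_mult g h) \<psi> = U g (U h \<psi>)) \<and>
     (\<forall>\<psi>\<in>H. continuous_on poincare_group (\<lambda>g. U g \<psi>))"


section \<open>Joint spectrum of the translations\<close>

definition projection_valued_measure :: "('s::finite minkowski set \<Rightarrow> 'h::chilbert opr) \<Rightarrow> bool" where
  "projection_valued_measure E \<longleftrightarrow>
     (\<forall>B\<in>sets borel. E B \<in> bounded_oprs \<and> E B o\<^sub>L E B = E B \<and> adj (E B) = E B) \<and>
     E UNIV = id_blinfun \<and>
     (\<forall>X. range X \<subseteq> sets borel \<and> disjoint_family X \<longrightarrow>
        (\<forall>\<psi>. (\<lambda>i::nat. blinfun_apply (E (X i)) \<psi>) sums blinfun_apply (E (\<Union>i. X i)) \<psi>))"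

definition vector_measure ::
    "('s::finite minkowski set \<Rightarrow> 'h::chilbert opr) \<Rightarrow> 'h \<Rightarrow> 's minkowski measure" where
  "vector_measure E \<psi> = measure_of UNIV (sets borel) (\<lambda>B. ennreal ((norm (blinfun_apply (E B) \<psi>))\<^sup>2))"

text \<open>\<open>E\<close> is the joint spectral measure of the generators \<open>P\<close> of the translations,
  \<open>U(x) = exp(i P x) = \<integral> exp(i p x) dE(p)\<close>, with the Minkowski product \<open>p x\<close>. The joint spectrum of
  the generators is the support of \<open>E\<close>.\<close>

definition translation_spectral_measure ::
    "('s::finite poincare \<Rightarrow> 'h::chilbert opr) \<Rightarrow> ('s minkowski set \<Rightarrow> 'h opr) \<Rightarrow> bool" where
  "translation_spectral_measure U E \<longleftrightarrow>
     projection_valued_measure E \<and>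
     (\<forall>x \<psi>. cinner \<psi> (blinfun_apply (U (x, mat 1)) \<psi>) =
        (\<integral>p. exp (\<i> * complex_of_real (mink p x)) \<partial>vector_measure E \<psi>))"

definition spectral_support :: "('s::finite minkowski set \<Rightarrow> 'h::chilbert opr) \<Rightarrow> 's minkowski set" where
  "spectral_support E = {p. \<forall>N. open N \<and> p \<in> N \<longrightarrow> E N \<noteq> 0}"

definition spectrum_condition :: "('s::finite poincare \<Rightarrow> 'h::chilbert opr) \<Rightarrow> bool" where
  "spectrum_condition U \<longleftrightarrow>
     (\<exists>E. translation_spectral_measure U E \<and> spectral_support E \<subseteq> forward_cone)"


section \<open>Local nets in the vacuum sector\<close>

type_synonym ('s, 'h) net = "'s minkowski set \<Rightarrow> 'h opr set"

definition region :: "'s::finite minkowski set \<Rightarrow> bool" where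
  "region R \<longleftrightarrow> open R \<and> bounded R"

definition ad :: "'h::chilbert opr \<Rightarrow> 'h opr \<Rightarrow> 'h opr" where
  "ad V T = V o\<^sub>L T o\<^sub>L adj V"

text \<open>The algebras act on a common Hilbert space, so the C*-inductive limit is the norm closure of
  the directed union.\<close>

definition quasilocal :: "('s::finite, 'h::chilbert) net \<Rightarrow> 'h opr set" where
  "quasilocal \<AA> = closure (\<Union>R\<in>{R. region R}. \<AA> R)"

definition local_net ::
    "('s::finite, 'h::chilbert) net \<Rightarrow> ('s poincare \<Rightarrow> 'h opr) \<Rightarrow> bool" where
  "local_net \<AA> U \<longleftrightarrow>
     (\<forall>R. region R \<longrightarrow> von_neumann_algebra (\<AA> R)) \<and>
     (\<forall>R1 R2. region R1 \<and> region R2 \<and> R1 \<subseteq> R2 \<longrightarrow> \<AA> R1 \<subseteq> \<AA> R2) \<and>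
     (\<forall>R1 R2. region R1 \<and> region R2 \<and> spacelike_separated R1 R2 \<longrightarrow>
        (\<forall>A1\<in>\<AA> R1. \<forall>A2\<in>\<AA> R2. A1 o\<^sub>L A2 = A2 o\<^sub>L A1)) \<and>
     (\<forall>g\<in>poincare_group. \<forall>R. region R \<longrightarrow> ad (U g) ` \<AA> R = \<AA> (poincare_act g ` R))"

definition positive_energy_net ::
    "('s::finite, 'h::chilbert) net \<Rightarrow> ('s poincare \<Rightarrow> 'h opr) \<Rightarrow> 'h \<Rightarrow> bool" where
  "positive_energy_net \<AA> U \<Omega> \<longleftrightarrow>
     local_net \<AA> U \<and>
     unitary_rep UNIV (\<lambda>g. blinfun_apply (U g)) \<and>
     spectrum_condition U \<and>
     norm \<Omega> = 1 \<and>
     (\<forall>g\<in>poincare_group. blinfun_apply (U g) \<Omega> = \<Omega>) \<and>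
     closure {blinfun_apply A \<Omega> |A. A \<in> quasilocal \<AA>} = UNIV"

definition vacuum_net ::
    "('s::finite, 'h::chilbert) net \<Rightarrow> ('s poincare \<Rightarrow> 'h opr) \<Rightarrow> 'h \<Rightarrow> bool" where
  "vacuum_net \<AA> U \<Omega> \<longleftrightarrow>
     positive_energy_net \<AA> U \<Omega> \<and>
     (\<forall>\<psi>. (\<forall>x. blinfun_apply (U (x, mat 1)) \<psi> = \<psi>) \<longrightarrow> (\<exists>c. \<psi> = c *\<^sub>C \<Omega>))"


section \<open>The scaling algebra\<close>

text \<open>Functions on the positive reals are represented as functions on \<open>real\<close> that vanish on
  the nonpositive reals, so that equality of functions is equality on the positive reals.\<close>

type_synonym 'h scaling = "real \<Rightarrow> 'h opr"

definition scaling_functions :: "'h::chilbert scaling set" where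
  "scaling_functions =
     {B. (\<forall>l. B l \<in> bounded_oprs) \<and> (\<forall>l\<le>0. B l = 0) \<and> (\<exists>M. \<forall>l. norm (B l) \<le> M)}"

definition scaling_one :: "'h::chilbert scaling" where
  "scaling_one = (\<lambda>l. if l > 0 then id_blinfun else 0)"

definition scaling_add :: "'h::chilbert scaling \<Rightarrow> 'h scaling \<Rightarrow> 'h scaling" where
  "scaling_add A B = (\<lambda>l. A l + B l)"

definition scaling_scale :: "complex \<Rightarrow> 'h::chilbert scaling \<Rightarrow> 'h scaling" where
  "scaling_scale c A = (\<lambda>l. scalar_opr c o\<^sub>L A l)"

definition scaling_mult :: "'h::chilbert scaling \<Rightarrow> 'h scaling \<Rightarrow> 'h scaling" where
  "scaling_mult A B = (\<lambda>l. A l o\<^sub>L B l)"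

definition scaling_adj :: "'h::chilbert scaling \<Rightarrow> 'h scaling" where
  "scaling_adj A = (\<lambda>l. adj (A l))"

text \<open>The group generated by Poincare transformations and dilations, with elements
  \<open>(\<mu>, x, \<Lambda>)\<close> and the product topology.\<close>

definition scaling_group :: "(real \<times> 's::finite poincare) set" where
  "scaling_group = {0<..} \<times> poincare_group"

definition scaling_act ::
    "('s::finite poincare \<Rightarrow> 'h::chilbert opr) \<Rightarrow> real \<times> 's poincare \<Rightarrow> 'h scaling \<Rightarrow> 'h scaling" where
  "scaling_act U = (\<lambda>(\<mu>, x, \<Lambda>) B. \<lambda>l. ad (U ((l * \<mu>) *\<^sub>R x, \<Lambda>)) (B (l * \<mu>)))"

definition scaling_local ::
    "('s::finite, 'h::chilbert) net \<Rightarrow> ('s poincare \<Rightarrow> 'h opr) \<Rightarrow> 's minkowski set \<Rightarrow> 'h scaling set" where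
  "scaling_local \<AA> U R =
     {A \<in> scaling_functions.
        (\<forall>l>0. A l \<in> \<AA> ((*\<^sub>R) l ` R)) \<and>
        (\<forall>g\<in>scaling_group.
           uniform_limit {0<..} (\<lambda>h. scaling_act U h A) (scaling_act U g A) (at g within scaling_group))}"

definition scaling_algebra ::
    "('s::finite, 'h::chilbert) net \<Rightarrow> ('s poincare \<Rightarrow> 'h opr) \<Rightarrow> 'h scaling set" where
  "scaling_algebra \<AA> U =
     {A \<in> scaling_functions.
        \<forall>e>0. \<exists>R B. region R \<and> B \<in> scaling_local \<AA> U R \<and> (\<forall>l>0. norm (A l - B l) \<le> e)}"

definition scaling_center ::
    "('s::finite, 'h::chilbert) net \<Rightarrow> ('s poincare \<Rightarrow> 'h opr) \<Rightarrow> 'h scaling set" where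
  "scaling_center \<AA> U =
     {C \<in> scaling_algebra \<AA> U. \<forall>A\<in>scaling_algebra \<AA> U. scaling_mult C A = scaling_mult A C}"


section \<open>Limit states\<close>

definition state_on :: "'h::chilbert scaling set \<Rightarrow> ('h scaling \<Rightarrow> complex) \<Rightarrow> bool" where
  "state_on S \<phi> \<longleftrightarrow>
     (\<forall>A\<in>S. \<forall>B\<in>S. \<phi> (scaling_add A B) = \<phi> A + \<phi> B) \<and>
     (\<forall>c. \<forall>A\<in>S. \<phi> (scaling_scale c A) = c * \<phi> A) \<and>
     (\<forall>A\<in>S. \<phi> (scaling_mult (scaling_adj A) A) \<in> \<real> \<and> Re (\<phi> (scaling_mult (scaling_adj A) A)) \<ge> 0) \<and>
     \<phi> scaling_one = 1"

definition asymptotic_mean ::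
    "('s::finite, 'h::chilbert) net \<Rightarrow> ('s poincare \<Rightarrow> 'h opr) \<Rightarrow> ('h scaling \<Rightarrow> complex) \<Rightarrow> bool" where
  "asymptotic_mean \<AA> U m \<longleftrightarrow>
     state_on (scaling_center \<AA> U) m \<and>
     (\<forall>C\<in>scaling_center \<AA> U. (\<exists>l0>0. \<forall>l. 0 < l \<and> l < l0 \<longrightarrow> C l = 0) \<longrightarrow> m C = 0)"

definition multiplicative_mean ::
    "('s::finite, 'h::chilbert) net \<Rightarrow> ('s poincare \<Rightarrow> 'h opr) \<Rightarrow> ('h scaling \<Rightarrow> complex) \<Rightarrow> bool" where
  "multiplicative_mean \<AA> U m \<longleftrightarrow>
     (\<forall>C\<in>scaling_center \<AA> U. \<forall>D\<in>scaling_center \<AA> U. m (scaling_mult C D) = m C * m D)"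

definition vacuum_expectation :: "'h::chilbert \<Rightarrow> 'h scaling \<Rightarrow> 'h scaling" where
  "vacuum_expectation \<Omega> A = (\<lambda>l. scalar_opr (cinner \<Omega> (blinfun_apply (A l) \<Omega>)))"

definition limit_state ::
    "('s::finite, 'h::chilbert) net \<Rightarrow> ('s poincare \<Rightarrow> 'h opr) \<Rightarrow> 'h \<Rightarrow> ('h scaling \<Rightarrow> complex) \<Rightarrow> bool" where
  "limit_state \<AA> U \<Omega> \<phi> \<longleftrightarrow>
     (\<exists>m. asymptotic_mean \<AA> U m \<and> (\<forall>A\<in>scaling_algebra \<AA> U. \<phi> A = m (vacuum_expectation \<Omega> A)))"

definition multiplicative_limit_state ::
    "('s::finite, 'h::chilbert) net \<Rightarrow> ('s poincare \<Rightarrow> 'h opr) \<Rightarrow> 'h \<Rightarrow> ('h scaling \<Rightarrow> complex) \<Rightarrow> bool" where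
  "multiplicative_limit_state \<AA> U \<Omega> \<phi> \<longleftrightarrow>
     (\<exists>m. asymptotic_mean \<AA> U m \<and> multiplicative_mean \<AA> U m \<and>
        (\<forall>A\<in>scaling_algebra \<AA> U. \<phi> A = m (vacuum_expectation \<Omega> A)))"

definition gns_triple ::
    "'h::chilbert scaling set \<Rightarrow> ('h scaling \<Rightarrow> complex) \<Rightarrow>
     'k::chilbert set \<Rightarrow> ('h scaling \<Rightarrow> 'k \<Rightarrow> 'k) \<Rightarrow> 'k \<Rightarrow> bool" where
  "gns_triple S \<phi> H \<pi> \<Omega> \<longleftrightarrow>
     hilbert_subspace H \<and>
     (\<forall>A\<in>S. bounded_opr_on H (\<pi> A)) \<and>
     (\<forall>A\<in>S. \<forall>B\<in>S. \<forall>x\<in>H. \<pi> (scaling_add A B) x = \<pi> A x + \<pi> B x) \<and>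
     (\<forall>c. \<forall>A\<in>S. \<forall>x\<in>H. \<pi> (scaling_scale c A) x = c *\<^sub>C \<pi> A x) \<and>
     (\<forall>A\<in>S. \<forall>B\<in>S. \<forall>x\<in>H. \<pi> (scaling_mult A B) x = \<pi> A (\<pi> B x)) \<and>
     (\<forall>A\<in>S. \<forall>x\<in>H. \<forall>y\<in>H. cinner (\<pi> (scaling_adj A) x) y = cinner x (\<pi> A y)) \<and>
     \<Omega> \<in> H \<and>
     closure {\<pi> A \<Omega> |A. A \<in> S} = H \<and>
     (\<forall>A\<in>S. \<phi> A = cinner \<Omega> (\<pi> A \<Omega>))"

definition poincare_implementation ::
    "('s::finite, 'h::chilbert) net \<Rightarrow> ('s poincare \<Rightarrow> 'h opr) \<Rightarrow>
     'k::chilbert set \<Rightarrow> ('h scaling \<Rightarrow> 'k \<Rightarrow> 'k) \<Rightarrow> 'k \<Rightarrow> ('s poincare \<Rightarrow> 'k \<Rightarrow> 'k) \<Rightarrow> bool" where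
  "poincare_implementation \<AA> U H \<pi> \<Omega> V \<longleftrightarrow>
     unitary_rep H V \<and>
     (\<forall>g\<in>poincare_group. \<forall>A\<in>scaling_algebra \<AA> U. V g (\<pi> A \<Omega>) = \<pi> (scaling_act U (1, g) A) \<Omega>)"


section \<open>Direct integrals\<close>

definition regular_borel_measure :: "'z::topological_space measure \<Rightarrow> bool" where
  "regular_borel_measure \<nu> \<longleftrightarrow>
     sets \<nu> = sets borel \<and>
     (\<forall>B\<in>sets \<nu>.
        emeasure \<nu> B = (SUP K\<in>{K. K \<subseteq> B \<and> compact K}. emeasure \<nu> K) \<and>
        emeasure \<nu> B = (INF V\<in>{V. B \<subseteq> V \<and> open V}. emeasure \<nu> V))"

text \<open>Measurability and integrability refer to the completed measure: otherwise no family of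
  vector fields with integrable square norms could be closed under almost everywhere modification.\<close>

definition fundamental_family ::
    "'z measure \<Rightarrow> ('z \<Rightarrow> 'k::chilbert set) \<Rightarrow> ('z \<Rightarrow> 'k) set \<Rightarrow> bool" where
  "fundamental_family \<nu> H G \<longleftrightarrow>
     (\<forall>\<xi>\<in>G. \<forall>z. \<xi> z \<in> H z) \<and>
     (\<lambda>z. 0) \<in> G \<and>
     (\<forall>\<xi>\<in>G. \<forall>\<eta>\<in>G. (\<lambda>z. \<xi> z + \<eta> z) \<in> G) \<and>
     (\<forall>c. \<forall>\<xi>\<in>G. (\<lambda>z. c *\<^sub>C \<xi> z) \<in> G) \<and>
     (\<forall>\<xi>\<in>G. integrable (completion \<nu>) (\<lambda>z. (norm (\<xi> z))\<^sup>2))"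

definition field_seminorm :: "'z measure \<Rightarrow> ('z \<Rightarrow> 'k::chilbert) \<Rightarrow> real" where
  "field_seminorm \<nu> \<xi> = sqrt (\<integral>z. (norm (\<xi> z))\<^sup>2 \<partial>completion \<nu>)"

definition complete_family ::
    "'z measure \<Rightarrow> ('z \<Rightarrow> 'k::chilbert set) \<Rightarrow> ('z \<Rightarrow> 'k) set \<Rightarrow> bool" where
  "complete_family \<nu> H D \<longleftrightarrow>
     fundamental_family \<nu> H D \<and>
     (\<forall>\<xi>\<in>D. \<forall>\<eta>. (\<forall>z. \<eta> z \<in> H z) \<and> (AE z in completion \<nu>. \<eta> z = \<xi> z) \<longrightarrow> \<eta> \<in> D) \<and>
     (\<forall>\<xi>\<in>D. \<forall>f\<in>borel_measurable (completion \<nu>).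
        (\<exists>M. AE z in completion \<nu>. cmod (f z) \<le> M) \<longrightarrow> (\<lambda>z. f z *\<^sub>C \<xi> z) \<in> D) \<and>
     (\<forall>X. (\<forall>n::nat. X n \<in> D) \<and>
        (\<forall>e>0. \<exists>N. \<forall>m\<ge>N. \<forall>n\<ge>N. field_seminorm \<nu> (\<lambda>z. X m z - X n z) < e) \<longrightarrow>
        (\<exists>\<xi>\<in>D. (\<lambda>n. field_seminorm \<nu> (\<lambda>z. X n z - \<xi> z)) \<longlonglongrightarrow> 0))"

definition family_closure ::
    "'z measure \<Rightarrow> ('z \<Rightarrow> 'k::chilbert set) \<Rightarrow> ('z \<Rightarrow> 'k) set \<Rightarrow> ('z \<Rightarrow> 'k) set" where
  "family_closure \<nu> H G = \<Inter>{D. G \<subseteq> D \<and> complete_family \<nu> H D}"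

definition vector_field_class ::
    "'z measure \<Rightarrow> ('z \<Rightarrow> 'k::chilbert set) \<Rightarrow> ('z \<Rightarrow> 'k) set \<Rightarrow> ('z \<Rightarrow> 'k) \<Rightarrow> ('z \<Rightarrow> 'k) set" where
  "vector_field_class \<nu> H G \<xi> = {\<eta> \<in> family_closure \<nu> H G. field_seminorm \<nu> (\<lambda>z. \<eta> z - \<xi> z) = 0}"

definition direct_integral ::
    "'z measure \<Rightarrow> ('z \<Rightarrow> 'k::chilbert set) \<Rightarrow> ('z \<Rightarrow> 'k) set \<Rightarrow> ('z \<Rightarrow> 'k) set set" where
  "direct_integral \<nu> H G = vector_field_class \<nu> H G ` family_closure \<nu> H G"

text \<open>Elements of the direct integral are equivalence classes of fields, so the linear structure and
  the inner product are expressed through representatives.\<close>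

definition unitary_to_direct_integral ::
    "'z measure \<Rightarrow> ('z \<Rightarrow> 'k::chilbert set) \<Rightarrow> ('z \<Rightarrow> 'k) set \<Rightarrow>
     'm::chilbert set \<Rightarrow> ('m \<Rightarrow> ('z \<Rightarrow> 'k) set) \<Rightarrow> bool" where
  "unitary_to_direct_integral \<nu> H G H0 W \<longleftrightarrow>
     bij_betw W H0 (direct_integral \<nu> H G) \<and>
     (\<forall>\<psi>\<in>H0. \<forall>\<phi>\<in>H0. \<forall>\<xi>\<in>W \<psi>. \<forall>\<eta>\<in>W \<phi>. (\<lambda>z. \<xi> z + \<eta> z) \<in> W (\<psi> + \<phi>)) \<and>
     (\<forall>c. \<forall>\<psi>\<in>H0. \<forall>\<xi>\<in>W \<psi>. (\<lambda>z. c *\<^sub>C \<xi> z) \<in> W (c *\<^sub>C \<psi>)) \<and>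
     (\<forall>\<psi>\<in>H0. \<forall>\<phi>\<in>H0. \<forall>\<xi>\<in>W \<psi>. \<forall>\<eta>\<in>W \<phi>.
        cinner \<psi> \<phi> = (\<integral>z. cinner (\<xi> z) (\<eta> z) \<partial>completion \<nu>))"

text \<open>The equation \<open>B = \<integral> d\<nu>(z) B(z)\<close> for an operator \<open>B\<close> on the direct integral. Two fields in
  \<open>family_closure\<close> have the same class iff they agree almost everywhere.\<close>

definition direct_integral_opr ::
    "'z measure \<Rightarrow> ('z \<Rightarrow> 'k::chilbert set) \<Rightarrow> ('z \<Rightarrow> 'k) set \<Rightarrow>
     (('z \<Rightarrow> 'k) set \<Rightarrow> ('z \<Rightarrow> 'k) set) \<Rightarrow> ('z \<Rightarrow> 'k \<Rightarrow> 'k) \<Rightarrow> bool" where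
  "direct_integral_opr \<nu> H G B Bz \<longleftrightarrow>
     (\<forall>z. bounded_opr_on (H z) (Bz z)) \<and>
     (\<exists>M. AE z in completion \<nu>. opr_norm_on (H z) (Bz z) \<le> M) \<and>
     (\<forall>\<xi>\<in>family_closure \<nu> H G. (\<lambda>z. Bz z (\<xi> z)) \<in> family_closure \<nu> H G) \<and>
     (\<forall>\<xi>\<in>family_closure \<nu> H G.
        B (vector_field_class \<nu> H G \<xi>) = vector_field_class \<nu> H G (\<lambda>z. Bz z (\<xi> z)))"

end

theory Submission
  imports Defs
begin

text \<open>Since \<open>scaling_act U (1, g)\<close> preserves the scaling algebra, \<open>\<Gamma>\<close> is stable under the fibrewise
  action of \<open>Uz z g\<close>, and there it agrees with \<open>U0 g\<close> on the dense set of vectors \<open>\<pi>0 A \<Omega>0\<close>. Both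
  actions are isometric for the same norm. So the fields mapped into a given complete family form a
  complete family themselves, which extends the stability to \<open>family_closure\<close>, and the agreement
  extends by density.\<close>

section \<open>Complex Hilbert spaces\<close>

text \<open>Two features shape the argument. First, \<open>family_closure\<close> is an
  intersection, so its elements are not presented as limits of fields in \<open>\<Gamma>\<close>.
  Membership is tested against every complete family, which is why preimages of complete families
  occur. Density is used only on the side of \<open>H0\<close>, where the GNS triple provides it;
  \<open>W\<close> turns seminorms of fields into norms of vectors, and the comparison of operators
  becomes a comparison of two vectors. Second, invariance of the scaling algebra conceals the group
  theory. Membership in \<open>scaling_local\<close> demands norm continuity of orbits under the
  group with dilations, and the orbit of a transformed function is the old orbit after right
  translation by \<open>g\<close>. This needs products of Poincare elements to stay in the group,
  where the delicate point is the sign of the time-time entry. Fibres need not be separable: lifts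
  of fields are chosen point by point, and completeness, not measurability of the choice, makes them
  admissible.\<close>

lemma scaleC_minus_one: "(-1) *\<^sub>C (x::'a::chilbert) = - x"
  using scaleC_of_real[of "-1" x] by simp

lemma cinner_self: "cinner x x = complex_of_real ((norm (x::'a::chilbert))\<^sup>2)"
proof -
  have "Im (cinner x x) = 0"
    using arg_cong[OF cinner_commute[of x x], of Im] by simp
  then show ?thesis
    by (simp add: complex_eq_iff Re_cinner power2_norm_eq_inner)
qed

lemma cinner_left_eqI:
  assumes "\<And>y. cinner x y = cinner x' (y::'a::chilbert)"
  shows "x = x'"
proof -
  have "inner x y = inner x' y" for y
    using arg_cong[OF assms[of y], of Re] by (simp add: Re_cinner)
  then have "inner (x - x') (x - x') = 0"
    by (simp add: inner_diff_left)
  then show ?thesis by simp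
qed

lemma hilbert_subspace_diff:
  assumes "hilbert_subspace H" "x \<in> H" "y \<in> H"
  shows "x - y \<in> H"
proof -
  have "(-1) *\<^sub>C y \<in> H" using assms unfolding hilbert_subspace_def by blast
  then have "x + - y \<in> H"
    using assms scaleC_minus_one[of y] unfolding hilbert_subspace_def by metis
  then show ?thesis by simp
qed

lemma unitary_on_norm:
  assumes "unitary_on H V" "x \<in> H"
  shows "norm (V x) = norm x"
proof -
  have "cinner (V x) (V x) = cinner x x" using assms unfolding unitary_on_def by blast
  then have "(norm (V x))\<^sup>2 = (norm x)\<^sup>2" by (metis cinner_self of_real_eq_iff)
  then show ?thesis by simp
qed

lemma unitary_on_diff:
  assumes "hilbert_subspace H" "unitary_on H V" "x \<in> H" "y \<in> H"
  shows "V (x - y) = V x - V y"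
proof -
  have m: "(-1) *\<^sub>C y \<in> H" using assms unfolding hilbert_subspace_def by blast
  have "V (x + (-1) *\<^sub>C y) = V x + (-1) *\<^sub>C V y"
    using assms m unfolding unitary_on_def clinear_on_def by metis
  then show ?thesis by (simp add: scaleC_minus_one)
qed

lemma unitary_on_dist:
  assumes "hilbert_subspace H" "unitary_on H V" "x \<in> H" "y \<in> H"
  shows "norm (V x - V y) = norm (x - y)"
  using assms by (metis hilbert_subspace_diff unitary_on_diff unitary_on_norm)

lemma unitary_on_mem: "unitary_on H V \<Longrightarrow> x \<in> H \<Longrightarrow> V x \<in> H"
  unfolding unitary_on_def by blast

lemma unitary_on_bounded_opr_on: "unitary_on H V \<Longrightarrow> bounded_opr_on H V"
  unfolding bounded_opr_on_def
  by (metis unitary_on_norm unitary_on_def mult_1 order_refl subset_refl)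

lemma unitary_on_opr_norm_on_le:
  assumes "hilbert_subspace H" "unitary_on H V"
  shows "opr_norm_on H V \<le> 1"
  unfolding opr_norm_on_def
proof (rule cSUP_least)
  show "{x \<in> H. norm x \<le> 1} \<noteq> {}"
    using assms unfolding hilbert_subspace_def by auto
qed (use assms in \<open>auto simp: unitary_on_norm\<close>)


section \<open>Adjoints of unitary operators\<close>

text \<open>\<open>adj\<close> is a definite description, accessible only through an operator that
  satisfies it; nondegeneracy of \<open>cinner\<close> gives the uniqueness.\<close>

lemma adj_eqI:
  fixes S T :: "'h::chilbert opr"
  assumes "S \<in> bounded_oprs" "\<And>x y. cinner (S x) y = cinner x (T y)"
  shows "adj T = S"
  unfolding adj_def
proof (rule the_equality)
  fix S' :: "'h opr"
  assume S': "S' \<in> bounded_oprs \<and> (\<forall>x y. cinner (S' x) y = cinner x (T y))"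
  show "S' = S"
  proof (rule blinfun_eqI)
    show "S' x = S x" for x
      by (rule cinner_left_eqI) (use S' assms(2) in simp)
  qed
qed (use assms in blast)

text \<open>For a unitary the inverse is an explicit candidate for the adjoint: injectivity of
  \<open>V\<close> makes it linear, preservation of norms makes it bounded.\<close>

lemma unitary_adj:
  fixes V :: "'h::chilbert opr"
  assumes V: "unitary_on UNIV (blinfun_apply V)"
  shows unitary_adj_bounded_oprs: "adj V \<in> bounded_oprs"
    and unitary_adj_cinner: "cinner (adj V x) y = cinner x (V y)"
    and unitary_adj_norm: "norm (adj V) \<le> 1"
    and unitary_bounded_oprs: "V \<in> bounded_oprs"
    and unitary_norm: "norm V \<le> 1"
proof -
  have sc: "V (c *\<^sub>C x) = c *\<^sub>C V x" for c x
    using V unfolding unitary_on_def clinear_on_def by blast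
  have nV: "norm (V x) = norm x" for x
    using unitary_on_norm[OF V] by simp
  have surj: "surj (blinfun_apply V)" using V unfolding unitary_on_def by blast
  have inj: "x = y" if "V x = V y" for x y
  proof -
    have "norm (x - y) = norm (V (x - y))" by (simp add: nV)
    also have "\<dots> = 0" using that by (simp add: blinfun.diff_right)
    finally show ?thesis by simp
  qed
  define S where "S = inv (blinfun_apply V)"
  have VS: "V (S x) = x" for x unfolding S_def by (simp add: surj surj_f_inv_f)
  have bl: "bounded_linear S"
  proof (rule bounded_linear_intro[where K=1])
    show "S (x + y) = S x + S y" for x y
      by (rule inj) (simp add: VS blinfun.add_right)
    show "S (r *\<^sub>R x) = r *\<^sub>R S x" for r x
      by (rule inj) (simp add: VS blinfun.scaleR_right)
    show "norm (S x) \<le> norm x * 1" for x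
      using nV[of "S x"] by (simp add: VS)
  qed
  have Sapp: "Blinfun S x = S x" for x by (simp add: bl bounded_linear_Blinfun_apply)
  have Sb: "Blinfun S \<in> bounded_oprs"
    unfolding bounded_oprs_def
  proof (clarsimp simp: Sapp)
    show "S (c *\<^sub>C x) = c *\<^sub>C S x" for c x
      by (rule inj) (simp add: VS sc)
  qed
  have Sc: "cinner (Blinfun S x) y = cinner x (V y)" for x y
  proof -
    have "cinner (V (S x)) (V y) = cinner (S x) y"
      using V unfolding unitary_on_def by blast
    then show ?thesis by (simp add: Sapp VS)
  qed
  have adj: "adj V = Blinfun S" by (rule adj_eqI) (use Sb Sc in auto)
  show "adj V \<in> bounded_oprs" "cinner (adj V x) y = cinner x (V y)"
    using Sb Sc by (auto simp: adj)
  show "norm (adj V) \<le> 1"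
    unfolding adj
  proof (rule norm_blinfun_bound)
    show "norm (Blinfun S x) \<le> 1 * norm x" for x
      using nV[of "S x"] by (simp add: VS Sapp)
  qed simp
  show "V \<in> bounded_oprs" unfolding bounded_oprs_def by (simp add: sc)
  show "norm V \<le> 1" by (rule norm_blinfun_bound) (simp_all add: nV)
qed

lemma bounded_oprs_compose:
  "S \<in> bounded_oprs \<Longrightarrow> T \<in> bounded_oprs \<Longrightarrow> S o\<^sub>L T \<in> bounded_oprs"
  unfolding bounded_oprs_def by simp

lemma unitary_adj_compose:
  fixes V W :: "'h::chilbert opr"
  assumes "unitary_on UNIV (blinfun_apply V)" "unitary_on UNIV (blinfun_apply W)"
  shows "adj (V o\<^sub>L W) = adj W o\<^sub>L adj V"
  by (rule adj_eqI)
    (use assms in \<open>auto simp: unitary_adj_cinner intro: bounded_oprs_compose unitary_adj_bounded_oprs\<close>)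

lemma ad_compose:
  fixes V W :: "'h::chilbert opr"
  assumes "unitary_on UNIV (blinfun_apply V)" "unitary_on UNIV (blinfun_apply W)"
  shows "ad (V o\<^sub>L W) T = ad V (ad W T)"
  unfolding ad_def unitary_adj_compose[OF assms] by (rule blinfun_eqI) simp

lemma ad_diff: "ad V (S - T) = ad V S - ad V T"
  unfolding ad_def by (rule blinfun_eqI) (simp add: blinfun.diff_left blinfun.diff_right)

lemma ad_zero [simp]: "ad V 0 = 0"
  using ad_diff[of V 0 0] by simp

lemma ad_bounded_oprs:
  assumes "unitary_on UNIV (blinfun_apply V)" "T \<in> bounded_oprs"
  shows "ad V T \<in> bounded_oprs"
  unfolding ad_def
  by (intro bounded_oprs_compose unitary_bounded_oprs unitary_adj_bounded_oprs assms)

lemma norm_ad_le: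
  assumes "unitary_on UNIV (blinfun_apply V)"
  shows "norm (ad V T) \<le> norm T"
proof -
  have "norm (ad V T) \<le> norm (V o\<^sub>L T) * norm (adj V)"
    unfolding ad_def by (rule norm_blinfun_compose)
  also have "\<dots> \<le> norm (V o\<^sub>L T) * 1"
    by (intro mult_left_mono unitary_adj_norm assms norm_ge_zero)
  also have "\<dots> \<le> norm V * norm T"
    using norm_blinfun_compose[of V T] by simp
  also have "\<dots> \<le> 1 * norm T"
    by (intro mult_right_mono unitary_norm assms norm_ge_zero)
  finally show ?thesis by simp
qed


section \<open>The Poincare group\<close>

text \<open>Allows the sign condition on \<open>L $ None $ None\<close> to be read as one on a
  Minkowski product.\<close>

lemma mink_time_axis:
  "mink (axis None 1) x = x $ None" "mink x (axis None 1) = (x::'s::finite minkowski) $ None"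
  by (simp_all add: mink_def axis_def)

text \<open>Each vector has spatial length strictly below its time component, so by Cauchy-Schwarz
  the spatial term cannot outweigh the product of the times.\<close>

lemma mink_timelike_pos:
  fixes u v :: "'s::finite minkowski"
  assumes "mink u u = 1" "mink v v = 1" "u $ None > 0" "v $ None > 0"
  shows "mink u v > 0"
proof -
  define n where "n w = L2_set (\<lambda>i. w $ Some i) UNIV" for w :: "'s minkowski"
  have less: "n w < w $ None" if "mink w w = 1" "w $ None > 0" for w :: "'s minkowski"
  proof (rule power2_less_imp_less)
    show "(n w)\<^sup>2 < (w $ None)\<^sup>2"
      using that by (simp add: n_def L2_set_def sum_nonneg mink_def power2_eq_square)
  qed (use that in simp)
  have "(\<Sum>i\<in>UNIV. u $ Some i * v $ Some i) \<le> (\<Sum>i\<in>UNIV. \<bar>u $ Some i\<bar> * \<bar>v $ Some i\<bar>)"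
    by (intro sum_mono) (simp flip: abs_mult)
  also have "\<dots> \<le> n u * n v"
    unfolding n_def by (rule L2_set_mult_ineq)
  also have "\<dots> < u $ None * v $ None"
    using less assms by (intro mult_strict_mono) (auto simp: n_def L2_set_nonneg)
  finally show ?thesis by (simp add: mink_def)
qed

text \<open>Only the time-time entry of the product needs an idea: it equals the Minkowski product
  of two future unit timelike vectors, the time axis pulled back by \<open>K\<close> and pushed
  forward by \<open>L\<close>.\<close>

lemma lorentz_group_mult:
  fixes K L :: "'s::finite lorentz"
  assumes K: "K \<in> lorentz_group" and L: "L \<in> lorentz_group"
  shows "K ** L \<in> lorentz_group"
proof -
  let ?e = "axis None 1 :: 's minkowski"
  have minkK: "mink (K *v x) (K *v y) = mink x y" for x y using K unfolding lorentz_group_def by blast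
  have minkL: "mink (L *v x) (L *v y) = mink x y" for x y using L unfolding lorentz_group_def by blast
  have component: "(A *v ?e) $ None = A $ None $ None" for A :: "'s lorentz"
    by (simp add: matrix_vector_mult_basis column_def)
  have "invertible K" using K unfolding lorentz_group_def by (simp add: invertible_det_nz)
  then obtain K' where K': "K ** K' = mat 1" unfolding invertible_def by blast
  \<comment> \<open>Invariance under \<open>K\<close> gives \<open>u\<close> the time component
    \<open>K $ None $ None\<close>, so \<open>u\<close> points to the future.\<close>
  define u where "u = K' *v ?e"
  have Ku: "K *v u = ?e" unfolding u_def by (simp add: matrix_vector_mul_assoc K')
  have e: "mink ?e ?e = 1" by (simp only: mink_time_axis) (simp add: axis_def)
  have "mink u u = 1" using minkK[of u u] by (simp add: Ku e)
  moreover have "u $ None > 0"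
  proof -
    have "u $ None = mink (K *v u) (K *v ?e)" by (simp add: minkK mink_time_axis)
    also have "\<dots> = K $ None $ None" by (simp add: Ku mink_time_axis component)
    finally show ?thesis using K unfolding lorentz_group_def by simp
  qed
  moreover have "mink (L *v ?e) (L *v ?e) = 1" by (simp add: minkL e)
  moreover have "(L *v ?e) $ None > 0" using L unfolding lorentz_group_def by (simp add: component)
  ultimately have "mink u (L *v ?e) > 0" by (intro mink_timelike_pos)
  also have "mink u (L *v ?e) = mink (K *v u) (K *v (L *v ?e))" by (simp add: minkK)
  also have "\<dots> = ((K ** L) *v ?e) $ None" by (simp add: Ku mink_time_axis matrix_vector_mul_assoc)
  also have "\<dots> = (K ** L) $ None $ None" by (rule component)
  finally have "(K ** L) $ None $ None > 0" .
  moreover have "det (K ** L) = 1"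
    using K L unfolding lorentz_group_def by (simp add: det_mul)
  moreover have "mink ((K ** L) *v x) ((K ** L) *v y) = mink x y" for x y
    by (simp add: minkK minkL flip: matrix_vector_mul_assoc)
  ultimately show ?thesis unfolding lorentz_group_def by blast
qed

lemma poincare_group_mult:
  "g \<in> poincare_group \<Longrightarrow> h \<in> poincare_group \<Longrightarrow> poincare_mult g h \<in> poincare_group"
  unfolding poincare_group_def poincare_mult_def by (auto intro: lorentz_group_mult)

lemma region_poincare_act:
  fixes g :: "'s::finite poincare"
  assumes g: "g \<in> poincare_group" and R: "region R"
  shows "region (poincare_act g ` R)"
proof -
  have "invertible (snd g)"
    using g unfolding poincare_group_def lorentz_group_def by (auto simp: invertible_det_nz)
  then have surj: "surj ((*v) (snd g))"
    by (simp add: invertible_right_inverse matrix_right_invertible_surjective)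
  have img: "poincare_act g ` R = (\<lambda>y. fst g + y) ` ((*v) (snd g) ` R)"
    by (auto simp: poincare_act_def image_image add.commute)
  have "open ((*v) (snd g) ` R)"
    using R surj by (auto simp: region_def intro!: open_surjective_linear_image matrix_vector_mul_linear)
  moreover have "bounded ((*v) (snd g) ` R)"
    using R by (auto simp: region_def intro!: bounded_linear_image matrix_vector_mul_bounded_linear)
  ultimately show ?thesis
    unfolding img region_def by (auto intro: open_translation bounded_translation)
qed

lemma region_scaleR:
  assumes "region R" "l > 0"
  shows "region ((*\<^sub>R) l ` R)"
  using assms by (auto simp: region_def intro: open_scaling bounded_scaling)


section \<open>The Poincare action on the scaling algebra\<close>

lemma scaling_act_apply:
  "scaling_act U (\<mu>, g) A l = ad (U ((l * \<mu>) *\<^sub>R fst g, snd g)) (A (l * \<mu>))"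
  by (cases g) (simp add: scaling_act_def)

text \<open>The outer action evaluates the inner one at \<open>l * \<mu>\<close>, so both elements
  occur at the same scale; scaling the translation part is a homomorphism because Lorentz matrices
  act linearly.\<close>

lemma scaling_act_compose:
  fixes U :: "'s::finite poincare \<Rightarrow> 'h::chilbert opr"
  assumes U: "unitary_rep UNIV (\<lambda>g. blinfun_apply (U g))"
    and g: "g \<in> poincare_group" and h: "h \<in> poincare_group"
  shows "scaling_act U (\<mu>, h) (scaling_act U (1, g) A) = scaling_act U (\<mu>, poincare_mult h g) A"
proof (rule ext)
  fix l
  let ?h = "((l * \<mu>) *\<^sub>R fst h, snd h)" and ?g = "((l * \<mu>) *\<^sub>R fst g, snd g)"
  have mem: "?h \<in> poincare_group" "?g \<in> poincare_group"
    using g h by (auto simp: poincare_group_def)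
  have mult: "poincare_mult ?h ?g = ((l * \<mu>) *\<^sub>R fst (poincare_mult h g), snd (poincare_mult h g))"
    by (simp add: poincare_mult_def scaleR_add_right matrix_vector_mult_scaleR)
  have "U (poincare_mult ?h ?g) = U ?h o\<^sub>L U ?g"
    by (rule blinfun_eqI) (use U mem in \<open>auto simp: unitary_rep_def\<close>)
  then have "ad (U (poincare_mult ?h ?g)) T = ad (U ?h) (ad (U ?g) T)" for T
    using U mem by (simp add: unitary_rep_def ad_compose)
  then show "scaling_act U (\<mu>, h) (scaling_act U (1, g) A) l
      = scaling_act U (\<mu>, poincare_mult h g) A l"
    by (simp add: scaling_act_apply flip: mult)
qed

lemma scaling_act_scaling_functions:
  assumes U: "unitary_rep UNIV (\<lambda>g. blinfun_apply (U g))"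
    and g: "g \<in> poincare_group" and A: "A \<in> scaling_functions"
  shows "scaling_act U (1, g) A \<in> scaling_functions"
proof -
  have un: "unitary_on UNIV (blinfun_apply (U (l *\<^sub>R fst g, snd g)))" for l
    using U g by (auto simp: unitary_rep_def poincare_group_def)
  obtain M where M: "\<And>l. norm (A l) \<le> M" using A by (auto simp: scaling_functions_def)
  have "norm (scaling_act U (1, g) A l) \<le> M" for l
    using norm_ad_le[OF un, of l "A l"] M[of l] by (simp add: scaling_act_apply)
  then show ?thesis
    using A un by (auto simp: scaling_functions_def scaling_act_apply intro: ad_bounded_oprs)
qed

text \<open>Right translation by \<open>g\<close> is affine in the entries of \<open>h\<close>; it
  serves to transport continuity of orbit maps.\<close>

lemma continuous_on_scaling_group_mult_right:
  "continuous_on S (\<lambda>(\<mu>, h). (\<mu>, poincare_mult h g))"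
  unfolding poincare_mult_def case_prod_unfold
    matrix_vector_mult_def matrix_matrix_mult_def
  by (intro continuous_intros)

text \<open>Localization is covariance of the net, since the group element used at scale
  \<open>l\<close> is the conjugate of \<open>g\<close> by the dilation. Continuity at
  \<open>k\<close> is that of the orbit of \<open>A\<close> at \<open>\<rho> k\<close>, pulled back
  along \<open>\<rho>\<close>.\<close>

lemma scaling_act_scaling_local:
  assumes U: "unitary_rep UNIV (\<lambda>g. blinfun_apply (U g))" and net: "local_net \<AA> U"
    and g: "g \<in> poincare_group" and R: "region R" and A: "A \<in> scaling_local \<AA> U R"
  shows "scaling_act U (1, g) A \<in> scaling_local \<AA> U (poincare_act g ` R)"
proof -
  have loc: "scaling_act U (1, g) A l \<in> \<AA> ((*\<^sub>R) l ` (poincare_act g ` R))" if l: "l > 0" for l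
  proof -
    let ?g = "(l *\<^sub>R fst g, snd g)"
    have "?g \<in> poincare_group" using g by (auto simp: poincare_group_def)
    then have "ad (U ?g) ` \<AA> ((*\<^sub>R) l ` R) = \<AA> (poincare_act ?g ` ((*\<^sub>R) l ` R))"
      using net region_scaleR[OF R l] by (auto simp: local_net_def)
    moreover have "poincare_act ?g ` ((*\<^sub>R) l ` R) = (*\<^sub>R) l ` (poincare_act g ` R)"
      by (simp add: poincare_act_def image_image scaleR_add_right matrix_vector_mult_scaleR)
    moreover have "A l \<in> \<AA> ((*\<^sub>R) l ` R)" using A l by (auto simp: scaling_local_def)
    ultimately show ?thesis by (auto simp: scaling_act_apply)
  qed
  define \<rho> where "\<rho> = (\<lambda>(\<mu>::real, h). (\<mu>, poincare_mult h g))"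
  have \<rho>_mem: "\<rho> k \<in> scaling_group" if "k \<in> scaling_group" for k
    using that g by (auto simp: \<rho>_def scaling_group_def intro: poincare_group_mult)
  have act_\<rho>: "scaling_act U k (scaling_act U (1, g) A) = scaling_act U (\<rho> k) A"
    if "k \<in> scaling_group" for k
    using that scaling_act_compose[OF U g] by (auto simp: \<rho>_def scaling_group_def)
  have "uniform_limit {0<..} (\<lambda>h. scaling_act U h (scaling_act U (1, g) A))
      (scaling_act U k (scaling_act U (1, g) A)) (at k within scaling_group)"
    if k: "k \<in> scaling_group" for k
  proof (rule uniform_limitI)
    fix e :: real assume e: "e > 0"
    let ?P = "\<lambda>h. \<forall>l\<in>{0<..}. dist (scaling_act U h A l) (scaling_act U (\<rho> k) A l) < e"
    have "uniform_limit {0<..} (\<lambda>h. scaling_act U h A) (scaling_act U (\<rho> k) A)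
        (at (\<rho> k) within scaling_group)"
      using A \<rho>_mem[OF k] by (simp add: scaling_local_def)
    from uniform_limitD[OF this e] obtain N where N: "open N" "\<rho> k \<in> N"
      and P: "\<And>h. h \<in> N \<Longrightarrow> h \<noteq> \<rho> k \<Longrightarrow> h \<in> scaling_group \<Longrightarrow> ?P h"
      unfolding eventually_at_topological by blast
    have "continuous_on scaling_group \<rho>"
      unfolding \<rho>_def by (rule continuous_on_scaling_group_mult_right)
    then have "(\<rho> \<longlongrightarrow> \<rho> k) (at k within scaling_group)" using k by (simp add: continuous_on)
    then have "\<forall>\<^sub>F h in at k within scaling_group. \<rho> h \<in> N" using N by (rule topological_tendstoD)
    moreover have "\<forall>\<^sub>F h in at k within scaling_group. h \<in> scaling_group"
      by (simp add: eventually_at_filter)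
    ultimately show "\<forall>\<^sub>F h in at k within scaling_group. \<forall>l\<in>{0<..}.
        dist (scaling_act U h (scaling_act U (1, g) A) l)
          (scaling_act U k (scaling_act U (1, g) A) l) < e"
    proof eventually_elim
      case (elim h)
      \<comment> \<open>The filter at \<open>\<rho> k\<close> is punctured and says nothing when
        \<open>\<rho> h = \<rho> k\<close>; there the distance is 0.\<close>
      have "?P (\<rho> h)"
      proof (cases "\<rho> h = \<rho> k")
        case False
        then show ?thesis using P elim \<rho>_mem by blast
      qed (simp add: e)
      then show ?case using elim k by (simp add: act_\<rho>)
    qed
  qed
  then show ?thesis
    using A loc scaling_act_scaling_functions[OF U g] unfolding scaling_local_def by blast
qed

text \<open>\<open>ad\<close> is additive and contractive at every scale, so transformed local
  approximants keep the error \<open>e\<close>.\<close>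

lemma scaling_act_scaling_algebra:
  assumes U: "unitary_rep UNIV (\<lambda>g. blinfun_apply (U g))" and net: "local_net \<AA> U"
    and g: "g \<in> poincare_group" and A: "A \<in> scaling_algebra \<AA> U"
  shows "scaling_act U (1, g) A \<in> scaling_algebra \<AA> U"
proof -
  have un: "unitary_on UNIV (blinfun_apply (U (l *\<^sub>R fst g, snd g)))" for l
    using U g by (auto simp: unitary_rep_def poincare_group_def)
  have "\<exists>R' B'. region R' \<and> B' \<in> scaling_local \<AA> U R' \<and>
      (\<forall>l>0. norm (scaling_act U (1, g) A l - B' l) \<le> e)" if e: "e > 0" for e
  proof -
    obtain R B where R: "region R" and B: "B \<in> scaling_local \<AA> U R"
      and AB: "\<And>l. l > 0 \<Longrightarrow> norm (A l - B l) \<le> e"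
      using A e unfolding scaling_algebra_def by blast
    have "norm (scaling_act U (1, g) A l - scaling_act U (1, g) B l) \<le> e" if "l > 0" for l
      using norm_ad_le[OF un, of l "A l - B l"] AB[OF that] by (simp add: scaling_act_apply ad_diff)
    then show ?thesis
      using region_poincare_act[OF g R] scaling_act_scaling_local[OF U net g R B] by blast
  qed
  then show ?thesis
    using A scaling_act_scaling_functions[OF U g] unfolding scaling_algebra_def by blast
qed


section \<open>Unitaries onto direct integrals\<close>

lemma field_seminorm_cong:
  "(\<And>z. norm (\<xi> z) = norm (\<eta> z)) \<Longrightarrow> field_seminorm \<nu> \<xi> = field_seminorm \<nu> \<eta>"
  by (simp add: field_seminorm_def)

lemma vector_field_class_self:
  "\<xi> \<in> family_closure \<nu> H G \<Longrightarrow> \<xi> \<in> vector_field_class \<nu> H G \<xi>"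
  by (simp add: vector_field_class_def field_seminorm_def)

lemma subset_family_closure: "G \<subseteq> family_closure \<nu> H G"
  by (auto simp: family_closure_def)

text \<open>If no complete family contained \<open>G\<close>, then \<open>family_closure\<close> would be an empty intersection,
  hence consist of all fields, including those with values outside of \<open>H z\<close>. Unless \<open>H0\<close> is trivial,
  the existence of \<open>W\<close> rules this out: the fields with values in \<open>H z\<close> would then form a complete
  family, with completeness inherited from \<open>H0\<close>.\<close>

locale unitary_onto_direct_integral =
  fixes \<nu> :: "'z measure" and H :: "'z \<Rightarrow> 'k::chilbert set" and G :: "('z \<Rightarrow> 'k) set"
    and H0 :: "'m::chilbert set" and W :: "'m \<Rightarrow> ('z \<Rightarrow> 'k) set"
  assumes unitary: "unitary_to_direct_integral \<nu> H G H0 W"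
    and H0: "hilbert_subspace H0"
    and H: "\<And>z. hilbert_subspace (H z)"
    and G_mem: "G \<subseteq> Pi UNIV H"
begin

lemma zero_mem: "0 \<in> H0"
  using H0 by (simp add: hilbert_subspace_def)

lemma bij: "bij_betw W H0 (direct_integral \<nu> H G)"
  using unitary unfolding unitary_to_direct_integral_def by blast

lemma field_of_vector:
  assumes "\<psi> \<in> H0"
  obtains \<xi> where "\<xi> \<in> family_closure \<nu> H G" "W \<psi> = vector_field_class \<nu> H G \<xi>" "\<xi> \<in> W \<psi>"
proof -
  have "W \<psi> \<in> direct_integral \<nu> H G" using bij assms unfolding bij_betw_def by blast
  then obtain \<xi> where "\<xi> \<in> family_closure \<nu> H G" "W \<psi> = vector_field_class \<nu> H G \<xi>"
    unfolding direct_integral_def by blast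
  then show thesis using that vector_field_class_self by blast
qed

lemma vector_of_field:
  assumes "\<xi> \<in> family_closure \<nu> H G"
  obtains \<psi> where "\<psi> \<in> H0" "W \<psi> = vector_field_class \<nu> H G \<xi>" "\<xi> \<in> W \<psi>"
proof -
  have "vector_field_class \<nu> H G \<xi> \<in> W ` H0"
    using bij assms unfolding bij_betw_def direct_integral_def by blast
  then show thesis using that vector_field_class_self[OF assms] by force
qed

lemma W_add:
  "\<psi> \<in> H0 \<Longrightarrow> \<phi> \<in> H0 \<Longrightarrow> \<xi> \<in> W \<psi> \<Longrightarrow> \<eta> \<in> W \<phi> \<Longrightarrow> (\<lambda>z. \<xi> z + \<eta> z) \<in> W (\<psi> + \<phi>)"
  using unitary unfolding unitary_to_direct_integral_def by blast

lemma W_uminus: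
  assumes "\<psi> \<in> H0" "\<xi> \<in> W \<psi>"
  shows "(\<lambda>z. - \<xi> z) \<in> W (- \<psi>)"
proof -
  have "(\<lambda>z. (-1) *\<^sub>C \<xi> z) \<in> W ((-1) *\<^sub>C \<psi>)"
    using unitary assms unfolding unitary_to_direct_integral_def by blast
  then show ?thesis by (simp add: scaleC_minus_one)
qed

lemma W_diff:
  assumes "\<psi> \<in> H0" "\<phi> \<in> H0" "\<xi> \<in> W \<psi>" "\<eta> \<in> W \<phi>"
  shows "(\<lambda>z. \<xi> z - \<eta> z) \<in> W (\<psi> - \<phi>)"
proof -
  have "- \<phi> \<in> H0" using hilbert_subspace_diff[OF H0 zero_mem assms(2)] by simp
  from W_add[OF assms(1) this assms(3) W_uminus[OF assms(2,4)]] show ?thesis by simp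
qed

text \<open>Holds for every representative, even one with a non-integrable square norm, because
  passing from complex to real integrals respects the default value 0.\<close>

lemma power2_norm_eq_integral:
  assumes "\<psi> \<in> H0" "\<xi> \<in> W \<psi>"
  shows "(norm \<psi>)\<^sup>2 = (\<integral>z. (norm (\<xi> z))\<^sup>2 \<partial>completion \<nu>)"
proof -
  have "cinner \<psi> \<psi> = (\<integral>z. cinner (\<xi> z) (\<xi> z) \<partial>completion \<nu>)"
    using unitary assms unfolding unitary_to_direct_integral_def by blast
  then have "complex_of_real ((norm \<psi>)\<^sup>2)
      = complex_of_real (\<integral>z. (norm (\<xi> z))\<^sup>2 \<partial>completion \<nu>)"
    unfolding cinner_self integral_complex_of_real .
  then show ?thesis unfolding of_real_eq_iff .
qed

lemma field_seminorm_eq_norm: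
  assumes "\<psi> \<in> H0" "\<xi> \<in> W \<psi>"
  shows "field_seminorm \<nu> \<xi> = norm \<psi>"
  by (simp add: field_seminorm_def flip: power2_norm_eq_integral[OF assms])

text \<open>The zero field represents the difference, which therefore has norm 0. This avoids
  showing that classes sharing a field coincide.\<close>

lemma vector_eqI:
  assumes "\<psi> \<in> H0" "\<phi> \<in> H0" "\<xi> \<in> W \<psi>" "\<xi> \<in> W \<phi>"
  shows "\<psi> = \<phi>"
  using field_seminorm_eq_norm[OF hilbert_subspace_diff[OF H0 assms(1,2)] W_diff[OF assms]]
  by (simp add: field_seminorm_def)

text \<open>A field whose square norm is not integrable has integral 0 by convention, so it would have to
  represent the zero vector, and so would its sum or its difference with a field representing a
  nonzero vector.\<close>

lemma integrable_of_family_closure_UNIV: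
  fixes \<xi> :: "'z \<Rightarrow> 'k"
  assumes UNIV: "family_closure \<nu> H G = UNIV" and nontriv: "\<psi> \<in> H0" "\<psi> \<noteq> 0"
  shows "integrable (completion \<nu>) (\<lambda>z. (norm (\<xi> z))\<^sup>2)"
proof (rule ccontr)
  assume not: "\<not> integrable (completion \<nu>) (\<lambda>z. (norm (\<xi> z))\<^sup>2)"
  have null: "\<zeta> \<in> W 0" if "\<not> integrable (completion \<nu>) (\<lambda>z. (norm (\<zeta> z))\<^sup>2)" for \<zeta>
  proof -
    obtain \<phi> where \<phi>: "\<phi> \<in> H0" "\<zeta> \<in> W \<phi>" using vector_of_field UNIV by blast
    have "(norm \<phi>)\<^sup>2 = 0"
      using power2_norm_eq_integral[OF \<phi>] not_integrable_integral_eq[OF that] by simp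
    then show ?thesis using \<phi> by simp
  qed
  obtain \<eta> where \<eta>: "\<eta> \<in> W \<psi>" using field_of_vector[OF nontriv(1)] by blast
  have \<xi>0: "\<xi> \<in> W 0" using null[OF not] .
  \<comment> \<open>By the parallelogram law the square norm of \<open>\<xi>\<close> is a
    combination of those of the sum, the difference and \<open>\<eta>\<close>; the last is
    integrable because \<open>\<eta>\<close> represents a nonzero vector.\<close>
  have "\<not> (integrable (completion \<nu>) (\<lambda>z. (norm (\<xi> z + \<eta> z))\<^sup>2) \<and>
      integrable (completion \<nu>) (\<lambda>z. (norm (\<xi> z - \<eta> z))\<^sup>2))"
  proof
    assume int: "integrable (completion \<nu>) (\<lambda>z. (norm (\<xi> z + \<eta> z))\<^sup>2) \<and>
      integrable (completion \<nu>) (\<lambda>z. (norm (\<xi> z - \<eta> z))\<^sup>2)"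
    have "integrable (completion \<nu>) (\<lambda>z. (norm (\<eta> z))\<^sup>2)"
    proof (rule ccontr)
      assume "\<not> ?thesis"
      with null \<eta> nontriv zero_mem vector_eqI show False by blast
    qed
    with int have "integrable (completion \<nu>)
        (\<lambda>z. ((norm (\<xi> z + \<eta> z))\<^sup>2 + (norm (\<xi> z - \<eta> z))\<^sup>2) / 2 - (norm (\<eta> z))\<^sup>2)"
      by (intro Bochner_Integration.integrable_diff integrable_divide
          Bochner_Integration.integrable_add) auto
    moreover have "((norm (\<xi> z + \<eta> z))\<^sup>2 + (norm (\<xi> z - \<eta> z))\<^sup>2) / 2 - (norm (\<eta> z))\<^sup>2
        = (norm (\<xi> z))\<^sup>2" for z
      by (simp add: power2_norm_eq_inner inner_add_left inner_add_right
          inner_diff_left inner_diff_right inner_commute add_divide_distrib)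
    ultimately show False using not by simp
  qed
  then consider "(\<lambda>z. \<xi> z + \<eta> z) \<in> W 0" | "(\<lambda>z. \<xi> z - \<eta> z) \<in> W 0"
    using null[of "\<lambda>z. \<xi> z + \<eta> z"] null[of "\<lambda>z. \<xi> z - \<eta> z"] by blast
  then have "\<eta> \<in> W 0"
  proof cases
    case 1
    from W_diff[OF zero_mem zero_mem this \<xi>0] show ?thesis by simp
  next
    case 2
    from W_diff[OF zero_mem zero_mem \<xi>0 this] show ?thesis by simp
  qed
  then show False using vector_eqI[OF nontriv(1) zero_mem \<eta>] nontriv by blast
qed

lemma complete_family_exists:
  assumes nontriv: "\<psi> \<in> H0" "\<psi> \<noteq> 0"
  obtains D where "G \<subseteq> D" "complete_family \<nu> H D"
proof (rule ccontr)
  assume "\<not> thesis"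
  then have "{D. G \<subseteq> D \<and> complete_family \<nu> H D} = {}" using that by blast
  then have UNIV: "family_closure \<nu> H G = UNIV" unfolding family_closure_def by (metis Inter_empty)
  have int: "integrable (completion \<nu>) (\<lambda>z. (norm (\<xi> z))\<^sup>2)" for \<xi> :: "'z \<Rightarrow> 'k"
    using integrable_of_family_closure_UNIV[OF UNIV nontriv] .
  define D where "D = {\<xi>. \<forall>z. \<xi> z \<in> H z}"
  have "\<exists>\<xi>\<in>D. (\<lambda>n. field_seminorm \<nu> (\<lambda>z. X n z - \<xi> z)) \<longlonglongrightarrow> 0"
    if X: "\<And>n. X n \<in> D"
      and cauchy: "\<forall>e>0. \<exists>N. \<forall>m\<ge>N. \<forall>n\<ge>N. field_seminorm \<nu> (\<lambda>z. X m z - X n z) < e"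
    for X :: "nat \<Rightarrow> 'z \<Rightarrow> 'k"
  proof -
    \<comment> \<open>Here every field represents a vector, so the Cauchy sequence can be moved to
      the closed subspace \<open>H0\<close> and its limit moved back.\<close>
    have "\<exists>\<phi>. \<phi> \<in> H0 \<and> X n \<in> W \<phi>" for n using vector_of_field[of "X n"] UNIV by blast
    then obtain \<phi> where \<phi>: "\<And>n. \<phi> n \<in> H0" "\<And>n. X n \<in> W (\<phi> n)" by metis
    have "norm (\<phi> m - \<phi> n) = field_seminorm \<nu> (\<lambda>z. X m z - X n z)" for m n
      by (rule field_seminorm_eq_norm[symmetric]) (use \<phi> W_diff hilbert_subspace_diff[OF H0] in auto)
    then have "Cauchy \<phi>" using cauchy by (simp add: Cauchy_def dist_norm)
    then obtain \<theta> where \<theta>: "\<phi> \<longlonglongrightarrow> \<theta>" using Cauchy_convergent convergent_def by blast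
    then have \<theta>_mem: "\<theta> \<in> H0"
      using H0 \<phi>(1) closed_sequentially unfolding hilbert_subspace_def by blast
    then obtain \<xi> where \<xi>: "\<xi> \<in> W \<theta>" using field_of_vector by blast
    have eq: "field_seminorm \<nu> (\<lambda>z. X n z - \<xi> z) = norm (\<phi> n - \<theta>)" for n
      by (rule field_seminorm_eq_norm)
        (use \<phi> \<xi> \<theta>_mem W_diff hilbert_subspace_diff[OF H0] in auto)
    have lim: "(\<lambda>n. field_seminorm \<nu> (\<lambda>z. X n z - \<xi> z)) \<longlonglongrightarrow> 0"
      unfolding eq using \<theta> by (simp add: LIM_zero tendsto_norm_zero)
    then have "(\<lambda>n. (field_seminorm \<nu> (\<lambda>z. X n z - \<xi> z))\<^sup>2) \<longlonglongrightarrow> 0\<^sup>2"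
      by (rule tendsto_power)
    then have "(\<lambda>n. \<integral>z. norm ((norm (X n z - \<xi> z))\<^sup>2) \<partial>completion \<nu>) \<longlonglongrightarrow> 0"
      by (simp add: field_seminorm_def)
    \<comment> \<open>Seminorm convergence is L1 convergence of the square distances; a subsequence
      converging almost everywhere places \<open>\<xi>\<close> in the closed fibres off a null
      set.\<close>
    from tendsto_L1_AE_subseq[OF int this] obtain r
      where ae: "AE z in completion \<nu>. (\<lambda>n. (norm (X (r n) z - \<xi> z))\<^sup>2) \<longlonglongrightarrow> 0"
      by blast
    have mem: "AE z in completion \<nu>. \<xi> z \<in> H z"
      using ae
    proof eventually_elim
      case (elim z)
      from tendsto_real_sqrt[OF elim] have "(\<lambda>n. X (r n) z) \<longlonglongrightarrow> \<xi> z"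
        by (simp add: LIM_zero_iff tendsto_norm_zero_iff)
      moreover have "X (r n) z \<in> H z" for n using X by (simp add: D_def)
      ultimately show ?case
        using H[of z] closed_sequentially[of "H z" "\<lambda>n. X (r n) z" "\<xi> z"] unfolding hilbert_subspace_def by blast
    qed
    \<comment> \<open>The representative of the limit may leave the fibres on that null set;
      resetting it to 0 there changes no seminorm.\<close>
    define \<xi>' where "\<xi>' = (\<lambda>z. if \<xi> z \<in> H z then \<xi> z else 0)"
    have "\<xi>' \<in> D" using H by (auto simp: D_def \<xi>'_def hilbert_subspace_def)
    moreover have "field_seminorm \<nu> (\<lambda>z. X n z - \<xi>' z) = field_seminorm \<nu> (\<lambda>z. X n z - \<xi> z)" for n
    proof -
      have "(\<integral>z. (norm (X n z - \<xi>' z))\<^sup>2 \<partial>completion \<nu>) = (\<integral>z. (norm (X n z - \<xi> z))\<^sup>2 \<partial>completion \<nu>)"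
      proof (rule integral_cong_AE)
        show "AE z in completion \<nu>. (norm (X n z - \<xi>' z))\<^sup>2 = (norm (X n z - \<xi> z))\<^sup>2"
          using mem by eventually_elim (simp add: \<xi>'_def)
      qed (use int in auto)
      then show ?thesis by (simp add: field_seminorm_def)
    qed
    ultimately show ?thesis using lim by (intro bexI[of _ \<xi>']) simp_all
  qed
  \<comment> \<open>Since all square norms are integrable, fibrewise membership is the only
    condition left to check in the remaining clauses.\<close>
  then have "complete_family \<nu> H D"
    using H int unfolding complete_family_def fundamental_family_def
    by (auto simp: D_def hilbert_subspace_def)
  moreover have "G \<subseteq> D" using G_mem by (auto simp: D_def)
  ultimately show False using \<open>\<not> thesis\<close> that by blast
qed

text \<open>A single complete family above \<open>G\<close> confines the whole intersection to the
  fibres; the nonzero vector guarantees that one exists.\<close>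

lemma family_closure_mem:
  assumes "\<psi> \<in> H0" "\<psi> \<noteq> 0" "\<xi> \<in> family_closure \<nu> H G"
  shows "\<xi> z \<in> H z"
proof -
  obtain D where "G \<subseteq> D" "complete_family \<nu> H D" using complete_family_exists[OF assms(1,2)] .
  then show ?thesis
    using assms(3) unfolding family_closure_def complete_family_def fundamental_family_def by blast
qed

end


section \<open>Decomposition of unitary operators\<close>

text \<open>Linearity transfers the algebraic clauses, isometry the integrability and Cauchy
  conditions, surjectivity the limits. Membership in \<open>H z\<close> is demanded separately
  because \<open>V z\<close> is unconstrained outside it.\<close>

lemma complete_family_unitary_vimage:
  fixes H :: "'z \<Rightarrow> 'k::chilbert set"
  assumes D: "complete_family \<nu> H D" and H: "\<And>z. hilbert_subspace (H z)"
    and V: "\<And>z. unitary_on (H z) (V z)"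
  shows "complete_family \<nu> H {\<xi>. (\<forall>z. \<xi> z \<in> H z) \<and> (\<lambda>z. V z (\<xi> z)) \<in> D}" (is "complete_family _ _ ?D")
proof -
  have D_mem: "\<forall>\<xi>\<in>D. \<forall>z. \<xi> z \<in> H z" and D_zero: "(\<lambda>z. 0) \<in> D"
    and D_add: "\<forall>\<xi>\<in>D. \<forall>\<eta>\<in>D. (\<lambda>z. \<xi> z + \<eta> z) \<in> D"
    and D_scale: "\<forall>c. \<forall>\<xi>\<in>D. (\<lambda>z. c *\<^sub>C \<xi> z) \<in> D"
    and D_int: "\<forall>\<xi>\<in>D. integrable (completion \<nu>) (\<lambda>z. (norm (\<xi> z))\<^sup>2)"
    and D_AE: "\<forall>\<xi>\<in>D. \<forall>\<eta>. (\<forall>z. \<eta> z \<in> H z) \<and> (AE z in completion \<nu>. \<eta> z = \<xi> z) \<longrightarrow> \<eta> \<in> D"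
    and D_mult: "\<forall>\<xi>\<in>D. \<forall>f\<in>borel_measurable (completion \<nu>).
        (\<exists>M. AE z in completion \<nu>. cmod (f z) \<le> M) \<longrightarrow> (\<lambda>z. f z *\<^sub>C \<xi> z) \<in> D"
    and D_complete: "\<forall>X. (\<forall>n::nat. X n \<in> D) \<and>
        (\<forall>e>0. \<exists>N. \<forall>m\<ge>N. \<forall>n\<ge>N. field_seminorm \<nu> (\<lambda>z. X m z - X n z) < e) \<longrightarrow>
        (\<exists>\<xi>\<in>D. (\<lambda>n. field_seminorm \<nu> (\<lambda>z. X n z - \<xi> z)) \<longlonglongrightarrow> 0)"
    using D unfolding complete_family_def fundamental_family_def by - (elim conjE, assumption)+
  have Vadd: "V z (x + y) = V z x + V z y" if "x \<in> H z" "y \<in> H z" for x y z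
    using V[of z] that unfolding unitary_on_def clinear_on_def by blast
  have Vscale: "V z (c *\<^sub>C x) = c *\<^sub>C V z x" if "x \<in> H z" for c x z
    using V[of z] that unfolding unitary_on_def clinear_on_def by blast
  have Hzero: "0 \<in> H z" and Hadd: "x \<in> H z \<Longrightarrow> y \<in> H z \<Longrightarrow> x + y \<in> H z"
    and Hscale: "x \<in> H z \<Longrightarrow> c *\<^sub>C x \<in> H z" for x y c z
    using H[of z] by (auto simp: hilbert_subspace_def)
  have Vzero: "V z 0 = 0" for z
    using Vadd[OF Hzero Hzero, of z] by simp
  have "fundamental_family \<nu> H ?D"
    unfolding fundamental_family_def
  proof (intro conjI ballI allI)
    show "(\<lambda>z. 0) \<in> ?D" by (simp add: D_zero Hzero Vzero)
    show "(\<lambda>z. \<xi> z + \<eta> z) \<in> ?D" if "\<xi> \<in> ?D" "\<eta> \<in> ?D" for \<xi> \<eta>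
      using that by (simp add: D_add Hadd Vadd)
    show "(\<lambda>z. c *\<^sub>C \<xi> z) \<in> ?D" if "\<xi> \<in> ?D" for c \<xi>
      using that by (simp add: D_scale Hscale Vscale)
    show "integrable (completion \<nu>) (\<lambda>z. (norm (\<xi> z))\<^sup>2)" if "\<xi> \<in> ?D" for \<xi>
    proof -
      have "integrable (completion \<nu>) (\<lambda>z. (norm (V z (\<xi> z)))\<^sup>2)"
        using that by (intro D_int[rule_format]) blast
      then show ?thesis using that by (simp add: unitary_on_norm[OF V])
    qed
  qed auto
  moreover have "\<eta> \<in> ?D"
    if "\<xi> \<in> ?D" "\<forall>z. \<eta> z \<in> H z" "AE z in completion \<nu>. \<eta> z = \<xi> z" for \<xi> \<eta>
  proof -
    have "(\<lambda>z. V z (\<xi> z)) \<in> D" using that(1) by blast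
    moreover have "\<forall>z. V z (\<eta> z) \<in> H z" using that(2) V unitary_on_mem by blast
    moreover have "AE z in completion \<nu>. V z (\<eta> z) = V z (\<xi> z)"
      using that(3) by eventually_elim simp
    ultimately have "(\<lambda>z. V z (\<eta> z)) \<in> D"
      by (rule D_AE[THEN bspec, THEN spec, THEN mp, OF _ conjI])
    then show ?thesis using that(2) by blast
  qed
  moreover have "(\<lambda>z. f z *\<^sub>C \<xi> z) \<in> ?D"
    if "\<xi> \<in> ?D" "f \<in> borel_measurable (completion \<nu>)" "\<exists>M. AE z in completion \<nu>. cmod (f z) \<le> M" for \<xi> f
  proof -
    have "(\<lambda>z. f z *\<^sub>C V z (\<xi> z)) \<in> D"
      by (rule D_mult[THEN bspec, THEN bspec, THEN mp]) (use that in blast)+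
    then show ?thesis using that(1) by (simp add: Hscale Vscale)
  qed
  moreover have "\<exists>\<xi>\<in>?D. (\<lambda>n. field_seminorm \<nu> (\<lambda>z. X n z - \<xi> z)) \<longlonglongrightarrow> 0"
    if X: "\<forall>n. X n \<in> ?D"
      and cauchy: "\<forall>e>0. \<exists>N. \<forall>m\<ge>N. \<forall>n\<ge>N. field_seminorm \<nu> (\<lambda>z. X m z - X n z) < e"
    for X :: "nat \<Rightarrow> 'z \<Rightarrow> 'k"
  proof -
    have iso: "field_seminorm \<nu> (\<lambda>z. V z (\<xi> z) - V z (\<eta> z)) = field_seminorm \<nu> (\<lambda>z. \<xi> z - \<eta> z)"
      if "\<And>z. \<xi> z \<in> H z" "\<And>z. \<eta> z \<in> H z" for \<xi> \<eta>
      by (rule field_seminorm_cong) (simp add: unitary_on_dist[OF H V] that)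
    have "\<forall>e>0. \<exists>N. \<forall>m\<ge>N. \<forall>n\<ge>N. field_seminorm \<nu> (\<lambda>z. V z (X m z) - V z (X n z)) < e"
      using cauchy X by (simp add: iso)
    moreover have "\<forall>n. (\<lambda>z. V z (X n z)) \<in> D" using X by blast
    ultimately obtain \<zeta> where \<zeta>: "\<zeta> \<in> D"
      and lim: "(\<lambda>n. field_seminorm \<nu> (\<lambda>z. V z (X n z) - \<zeta> z)) \<longlonglongrightarrow> 0"
      using D_complete[THEN spec, of "\<lambda>n z. V z (X n z)"] by blast
    \<comment> \<open>The limit is found in \<open>D\<close> and lifted pointwise; any lift is
      admissible, since its image is \<open>\<zeta>\<close> itself.\<close>
    have "\<exists>x\<in>H z. V z x = \<zeta> z" for z
      using D_mem[THEN bspec, OF \<zeta>, THEN spec, of z] V[of z] unfolding unitary_on_def by (metis imageE)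
    then obtain \<xi> where \<xi>: "\<And>z. \<xi> z \<in> H z" "\<And>z. V z (\<xi> z) = \<zeta> z" by metis
    have "field_seminorm \<nu> (\<lambda>z. V z (X n z) - \<zeta> z) = field_seminorm \<nu> (\<lambda>z. X n z - \<xi> z)" for n
      using iso[of "X n" \<xi>] X \<xi> by simp
    then show ?thesis using lim \<zeta> \<xi> by (intro bexI[of _ \<xi>]) auto
  qed
  ultimately show ?thesis unfolding complete_family_def by blast
qed

text \<open>The preimage of each complete \<open>D\<close> above \<open>G\<close> is one of the
  families being intersected. If there is no such \<open>D\<close>, nothing is to be tested.\<close>

lemma family_closure_unitary:
  assumes H: "\<And>z. hilbert_subspace (H z)" and V: "\<And>z. unitary_on (H z) (V z)"
    and G_mem: "G \<subseteq> Pi UNIV H"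
    and G: "(\<lambda>\<xi> z. V z (\<xi> z)) ` G \<subseteq> G"
    and \<xi>: "\<xi> \<in> family_closure \<nu> H G"
  shows "(\<lambda>z. V z (\<xi> z)) \<in> family_closure \<nu> H G"
  unfolding family_closure_def
proof clarify
  fix D assume D: "G \<subseteq> D" "complete_family \<nu> H D"
  let ?D = "{\<xi>. (\<forall>z. \<xi> z \<in> H z) \<and> (\<lambda>z. V z (\<xi> z)) \<in> D}"
  have "G \<subseteq> ?D" using D(1) G G_mem by blast
  with complete_family_unitary_vimage[OF D(2) H V] have "family_closure \<nu> H G \<subseteq> ?D"
    unfolding family_closure_def by blast
  then show "(\<lambda>z. V z (\<xi> z)) \<in> D" using \<xi> by blast
qed

context unitary_onto_direct_integral
begin

lemma W_unitary:
  assumes V0: "unitary_on H0 V0" and V: "\<And>z. unitary_on (H z) (V z)"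
    and G: "(\<lambda>\<xi> z. V z (\<xi> z)) ` G \<subseteq> G"
    and S: "S \<subseteq> H0" "H0 \<subseteq> closure S"
    and intertwine: "\<And>\<phi>. \<phi> \<in> S \<Longrightarrow> \<exists>\<eta>\<in>W \<phi>. (\<forall>z. \<eta> z \<in> H z) \<and> (\<lambda>z. V z (\<eta> z)) \<in> W (V0 \<phi>)"
    and \<psi>: "\<psi> \<in> H0" and \<xi>: "\<xi> \<in> family_closure \<nu> H G" "\<xi> \<in> W \<psi>"
  shows "W (V0 \<psi>) = vector_field_class \<nu> H G (\<lambda>z. V z (\<xi> z))"
proof -
  have V\<xi>: "(\<lambda>z. V z (\<xi> z)) \<in> family_closure \<nu> H G"
    by (rule family_closure_unitary[OF H V G_mem G \<xi>(1)])
  then obtain \<theta> where \<theta>: "\<theta> \<in> H0" "W \<theta> = vector_field_class \<nu> H G (\<lambda>z. V z (\<xi> z))"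
    "(\<lambda>z. V z (\<xi> z)) \<in> W \<theta>"
    by (rule vector_of_field)
  have V0_mem: "V0 \<phi> \<in> H0" if "\<phi> \<in> H0" for \<phi>
    using V0 that by (rule unitary_on_mem)
  \<comment> \<open>For trivial \<open>H0\<close> the values of \<open>\<xi>\<close> may lie outside
    the fibres, but then both vectors are 0. Otherwise \<open>\<phi>\<close> in \<open>S\<close>
    approximates \<open>\<psi>\<close>, and two isometries bound both parts of the distance by
    \<open>norm (\<psi> - \<phi>)\<close>.\<close>
  have "\<theta> = V0 \<psi>"
  proof (cases "\<forall>\<psi>\<in>H0. \<psi> = 0")
    case True
    then show ?thesis using \<theta>(1) V0_mem[OF \<psi>] by metis
  next
    case False
    then have \<xi>_mem: "\<xi> z \<in> H z" for z
      using family_closure_mem \<xi>(1) by blast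
    have "norm (\<theta> - V0 \<psi>) \<le> e" if "e > 0" for e
    proof -
      obtain \<phi> where \<phi>: "\<phi> \<in> S" "dist \<phi> \<psi> < e / 2"
        using \<psi> S(2) \<open>e > 0\<close> closure_approachable[of \<psi> S] by (meson half_gt_zero subsetD)
      have \<phi>_mem: "\<phi> \<in> H0" using \<phi>(1) S(1) by blast
      obtain \<eta> where \<eta>: "\<eta> \<in> W \<phi>" "\<And>z. \<eta> z \<in> H z" "(\<lambda>z. V z (\<eta> z)) \<in> W (V0 \<phi>)"
        using intertwine[OF \<phi>(1)] by blast
      have "norm (\<theta> - V0 \<phi>) = field_seminorm \<nu> (\<lambda>z. V z (\<xi> z) - V z (\<eta> z))"
        by (rule field_seminorm_eq_norm[symmetric])
          (use \<theta> \<eta> V0_mem \<phi>_mem W_diff hilbert_subspace_diff[OF H0] in auto)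
      also have "\<dots> = field_seminorm \<nu> (\<lambda>z. \<xi> z - \<eta> z)"
        by (rule field_seminorm_cong) (simp add: unitary_on_dist[OF H V] \<xi>_mem \<eta>(2))
      also have "\<dots> = norm (\<psi> - \<phi>)"
        by (rule field_seminorm_eq_norm)
          (use \<psi> \<xi> \<eta> \<phi>_mem W_diff hilbert_subspace_diff[OF H0] in auto)
      finally have "norm (\<theta> - V0 \<phi>) < e / 2"
        using \<phi>(2) by (simp add: dist_norm norm_minus_commute)
      moreover have "norm (V0 \<phi> - V0 \<psi>) < e / 2"
        using \<phi>(2) unitary_on_dist[OF H0 V0 \<phi>_mem \<psi>] by (simp add: dist_norm)
      ultimately show ?thesis
        using norm_triangle_ineq[of "\<theta> - V0 \<phi>" "V0 \<phi> - V0 \<psi>"] by simp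
    qed
    then have "norm (\<theta> - V0 \<psi>) \<le> 0" by (rule field_le_epsilon) simp
    then show ?thesis by simp
  qed
  then show ?thesis using \<theta>(2) by simp
qed

lemma direct_integral_opr_unitary:
  assumes V0: "unitary_on H0 V0" and V: "\<And>z. unitary_on (H z) (V z)"
    and G: "(\<lambda>\<xi> z. V z (\<xi> z)) ` G \<subseteq> G"
    and S: "S \<subseteq> H0" "H0 \<subseteq> closure S"
    and intertwine: "\<And>\<phi>. \<phi> \<in> S \<Longrightarrow> \<exists>\<eta>\<in>W \<phi>. (\<forall>z. \<eta> z \<in> H z) \<and> (\<lambda>z. V z (\<eta> z)) \<in> W (V0 \<phi>)"
  shows "direct_integral_opr \<nu> H G (\<lambda>v. W (V0 (the_inv_into H0 W v))) V"
  unfolding direct_integral_opr_def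
proof (intro conjI allI ballI)
  show "bounded_opr_on (H z) (V z)" for z by (rule unitary_on_bounded_opr_on[OF V])
  show "\<exists>M. AE z in completion \<nu>. opr_norm_on (H z) (V z) \<le> M"
    using unitary_on_opr_norm_on_le[OF H V] by (intro exI[of _ 1]) simp
  fix \<xi> assume \<xi>: "\<xi> \<in> family_closure \<nu> H G"
  show "(\<lambda>z. V z (\<xi> z)) \<in> family_closure \<nu> H G"
    by (rule family_closure_unitary[OF H V G_mem G \<xi>])
  obtain \<psi> where \<psi>: "\<psi> \<in> H0" "W \<psi> = vector_field_class \<nu> H G \<xi>" "\<xi> \<in> W \<psi>"
    using vector_of_field[OF \<xi>] .
  have "the_inv_into H0 W (vector_field_class \<nu> H G \<xi>) = \<psi>"
    using bij \<psi>(1) the_inv_into_f_f unfolding \<psi>(2)[symmetric] bij_betw_def by fast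
  then show "W (V0 (the_inv_into H0 W (vector_field_class \<nu> H G \<xi>)))
      = vector_field_class \<nu> H G (\<lambda>z. V z (\<xi> z))"
    using W_unitary[OF V0 V G S intertwine \<psi>(1) \<xi> \<psi>(3)] by simp
qed

end

theorem proposition3p4:
  fixes \<AA> :: "('s::finite, 'h::chilbert) net"
    and U :: "'s poincare \<Rightarrow> 'h opr"
    and \<Omega> :: 'h
    and \<omega>0 :: "'h scaling \<Rightarrow> complex"
    and H0 :: "'m::chilbert set"
    and \<pi>0 :: "'h scaling \<Rightarrow> 'm \<Rightarrow> 'm"
    and \<Omega>0 :: 'm
    and U0 :: "'s poincare \<Rightarrow> 'm \<Rightarrow> 'm"
    and \<nu> :: "'z::t2_space measure"
    and \<omega>z :: "'z \<Rightarrow> 'h scaling \<Rightarrow> complex"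
    and Hz :: "'z \<Rightarrow> 'k::chilbert set"
    and \<pi>z :: "'z \<Rightarrow> 'h scaling \<Rightarrow> 'k \<Rightarrow> 'k"
    and \<Omega>z :: "'z \<Rightarrow> 'k"
    and Uz :: "'z \<Rightarrow> 's poincare \<Rightarrow> 'k \<Rightarrow> 'k"
    and \<Gamma> :: "('z \<Rightarrow> 'k) set"
    and W :: "'m \<Rightarrow> ('z \<Rightarrow> 'k) set"
  assumes net: "vacuum_net \<AA> U \<Omega>"
    and limit0: "limit_state \<AA> U \<Omega> \<omega>0"
    and gns0: "gns_triple (scaling_algebra \<AA> U) \<omega>0 H0 \<pi>0 \<Omega>0"
    and impl0: "poincare_implementation \<AA> U H0 \<pi>0 \<Omega>0 U0"
    and compact: "compact (UNIV :: 'z set)"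
    and regular: "regular_borel_measure \<nu>"
    and prob: "prob_space \<nu>"
    and limitz: "\<And>z. multiplicative_limit_state \<AA> U \<Omega> (\<omega>z z)"
    and gnsz: "\<And>z. gns_triple (scaling_algebra \<AA> U) (\<omega>z z) (Hz z) (\<pi>z z) (\<Omega>z z)"
    and implz: "\<And>z. poincare_implementation \<AA> U (Hz z) (\<pi>z z) (\<Omega>z z) (Uz z)"
    and decomposition: "\<And>A. A \<in> scaling_algebra \<AA> U \<Longrightarrow> has_bochner_integral \<nu> (\<lambda>z. \<omega>z z A) (\<omega>0 A)"
    and center_onto: "(\<lambda>C z. \<omega>z z C) ` scaling_center \<AA> U = {f. continuous_on UNIV f}"
    and Gamma: "\<Gamma> = {(\<lambda>z. \<pi>z z A (\<Omega>z z)) |A. A \<in> scaling_algebra \<AA> U}"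
    and unitary: "unitary_to_direct_integral \<nu> Hz \<Gamma> H0 W"
    and identification: "\<And>A. A \<in> scaling_algebra \<AA> U \<Longrightarrow>
           W (\<pi>0 A \<Omega>0) = vector_field_class \<nu> Hz \<Gamma> (\<lambda>z. \<pi>z z A (\<Omega>z z))"
  shows "\<forall>g\<in>poincare_group.
           direct_integral_opr \<nu> Hz \<Gamma> (\<lambda>v. W (U0 g (the_inv_into H0 W v))) (\<lambda>z. Uz z g)"
proof
  fix g :: "'s poincare"
  assume g: "g \<in> poincare_group"
  let ?S = "scaling_algebra \<AA> U"
  let ?\<theta> = "\<lambda>A z. \<pi>z z A (\<Omega>z z)"
  have act: "scaling_act U (1, g) A \<in> ?S" if "A \<in> ?S" for A
    using net that by (intro scaling_act_scaling_algebra g)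
      (auto simp: vacuum_net_def positive_energy_net_def)
  have H0: "hilbert_subspace H0" and H0_closure: "closure {\<pi>0 A \<Omega>0 |A. A \<in> ?S} = H0"
    using gns0 unfolding gns_triple_def by blast+
  have Hz: "hilbert_subspace (Hz z)" and \<theta>_mem: "A \<in> ?S \<Longrightarrow> ?\<theta> A z \<in> Hz z" for A z
    using gnsz[of z] unfolding gns_triple_def bounded_opr_on_def by blast+
  interpret unitary_onto_direct_integral \<nu> Hz \<Gamma> H0 W
  proof
    show "\<Gamma> \<subseteq> Pi UNIV Hz" unfolding Gamma using \<theta>_mem by blast
  qed (fact unitary H0 Hz)+
  \<comment> \<open>The transformed algebra element is the same in all fibres, so the image is again
    a field of \<open>\<Gamma>\<close> and not merely fibrewise of that form.\<close>
  have Uz_\<theta>: "(\<lambda>z. Uz z g (?\<theta> A z)) = ?\<theta> (scaling_act U (1, g) A)" if "A \<in> ?S" for A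
  proof (rule ext)
    show "Uz z g (?\<theta> A z) = ?\<theta> (scaling_act U (1, g) A) z" for z
      using implz[of z] g that unfolding poincare_implementation_def by blast
  qed
  have \<theta>_W: "?\<theta> A \<in> W (\<pi>0 A \<Omega>0)" if "A \<in> ?S" for A
    unfolding identification[OF that]
    by (intro vector_field_class_self subset_family_closure[THEN subsetD])
      (use that in \<open>auto simp: Gamma\<close>)
  show "direct_integral_opr \<nu> Hz \<Gamma> (\<lambda>v. W (U0 g (the_inv_into H0 W v))) (\<lambda>z. Uz z g)"
  proof (rule direct_integral_opr_unitary)
    show "unitary_on H0 (U0 g)"
      using impl0 g by (simp add: poincare_implementation_def unitary_rep_def)
    show "unitary_on (Hz z) (Uz z g)" for z
      using implz[of z] g by (simp add: poincare_implementation_def unitary_rep_def)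
    show "(\<lambda>\<xi> z. Uz z g (\<xi> z)) ` \<Gamma> \<subseteq> \<Gamma>"
    proof
      fix \<eta> assume "\<eta> \<in> (\<lambda>\<xi> z. Uz z g (\<xi> z)) ` \<Gamma>"
      then obtain A where A: "A \<in> ?S" "\<eta> = (\<lambda>z. Uz z g (?\<theta> A z))" unfolding Gamma by blast
      have "\<eta> = ?\<theta> (scaling_act U (1, g) A)" using A Uz_\<theta> by simp
      then show "\<eta> \<in> \<Gamma>" using act[OF A(1)] unfolding Gamma by blast
    qed
    show "{\<pi>0 A \<Omega>0 |A. A \<in> ?S} \<subseteq> H0" "H0 \<subseteq> closure {\<pi>0 A \<Omega>0 |A. A \<in> ?S}"
      using closure_subset[of "{\<pi>0 A \<Omega>0 |A. A \<in> ?S}"] by (simp_all add: H0_closure)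
    show "\<exists>\<eta>\<in>W \<phi>. (\<forall>z. \<eta> z \<in> Hz z) \<and> (\<lambda>z. Uz z g (\<eta> z)) \<in> W (U0 g \<phi>)"
      if \<phi>: "\<phi> \<in> {\<pi>0 A \<Omega>0 |A. A \<in> ?S}" for \<phi>
    proof -
      obtain A where A: "A \<in> ?S" "\<phi> = \<pi>0 A \<Omega>0" using \<phi> by blast
      have "U0 g \<phi> = \<pi>0 (scaling_act U (1, g) A) \<Omega>0"
        using impl0 g A by (simp add: poincare_implementation_def)
      then have "(\<lambda>z. Uz z g (?\<theta> A z)) \<in> W (U0 g \<phi>)"
        using \<theta>_W[OF act[OF A(1)]] Uz_\<theta>[OF A(1)] by simp
      then show ?thesis
        using \<theta>_W[OF A(1)] \<theta>_mem[OF A(1)] by (intro bexI[of _ "?\<theta> A"]) (simp_all add: A(2))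
    qed
  qed
qed

end
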